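(* Let $m\ge3$, $n\ge1$, and let $P_m,P_{m-1},P_{m-2}$ be homogeneous operators of order $m,m-1,m-2$ on $\mathbb{R}_t\times\mathbb{R}^n_x$, with $c_{m,0}=1$, $c_{m-1,0}>0$, $c_{m-2,0}>0$. Let $P_{m-2}(\partial_t,\partial_x)$ and $P_m(\partial_t,\partial_x)$ be (possibly weakly) hyperbolic and $P_{m-1}(\partial_t,\partial_x)$ be strictly hyperbolic. Assume that $P_{m-2}(\lambda,\xi')$ and $P_{m-1}(\lambda,\xi')$ interlace and that $P_{m-1}(\lambda,\xi')$ and $P_m(\lambda,\xi')$ interlace, for any $\xi'\in S^{n-1}$, and that there is no $(\lambda,\xi')\in\mathbb{R}\times S^{n-1}$ such that $P_{m-2}(\lambda,\xi')=P_{m-1}(\lambda,\xi')=P_m(\lambda,\xi')=0$. Let $a_j(\xi')$ be the roots of $P_m(\lambda,\xi')$, $\xi'\in S^{n-1}$, and let $Q_2=P_m+P_{m-1}+P_{m-2}$. Then we may label the $m$ roots $\lambda_j(\xi)$ of $Q_2(\lambda,i\xi)$, $\xi\in\mathbb{R}^n$, in such a way that they are described as follows, where $\xi'=\xi/|\xi|$. (i) If $P_{m-1}(a_j(\xi'),\xi')\ne0$ and $\check P_{m,j}(a_j(\xi'),\xi')\ne0$, that is, $a_j(\xi')$ is a simple root of $P_m(\lambda,\xi')$ and it is not a root of $P_{m-1}(\lambda,\xi')$, then, as $|\xi|\to\infty$, $$\lambda_j(\xi)=i|\xi|a_j(\xi')-\frac{P_{m-1}(a_j(\xi'),\xi')}{\check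 P_{m,j}(a_j(\xi'),\xi')}+o(1).$$ (ii) If $P_{m-1}(a_j(\xi'),\xi')=0$ and $\check P_{m,j}(a_j(\xi'),\xi')\ne0$, that is, $a_j(\xi')$ is a simple root of both $P_{m-1}(\lambda,\xi')$ and $P_m(\lambda,\xi')$, then, as $|\xi|\to\infty$, $$\lambda_j(\xi)=i|\xi|a_j(\xi')+i|\xi|^{-1}\frac{P_{m-2}(a_j(\xi'),\xi')}{\check P_{m,j}(a_j(\xi'),\xi')}-|\xi|^{-2}\frac{P_{m-2}(a_j(\xi'),\xi')\,\tilde P_{m-1}(a_j(\xi'),\xi')}{\big(\check P_{m,j}(a_j(\xi'),\xi')\big)^2}+o(|\xi|^{-2}),$$ where $\tilde P_{m-1}(\lambda,\xi')=\check P_{m-1,j-1}(\lambda,\xi')$ if $a_j(\xi')=b_{j-1}(\xi')$, and $\tilde P_{m-1}(\lambda,\xi')=\check P_{m-1,j}(\lambda,\xi')$ if $a_j(\xi')=b_j(\xi')$. (iii) If $a_j(\xi')=b_j(\xi')=a_{j+1}(\xi')$, that is, $a_j(\xi')$ is a simple root of $P_{m-1}(\lambda,\xi')$ and a double root of $P_m(\lambda,\xi')$, then, as $|\xi|\to\infty$, $$\lambda_{j,j+1}(\xi)=i|\xi|a_j(\xi')+\kappa_\pm(\xi')+o(1),$$ where $\kappa_\pm(\xi')$ are the two solutions to $$\kappa^2\check P_{m,j,j+1}(a_j(\xi'),\xi')+\kappa\,\check P_{m-1,j}(a_j(\xi'),\xi')+P_{m-2}(a_j(\xi'),\xi')=0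 .$$
   Context: A homogeneous operator of order $r$ is $P_r(\partial_t,\partial_x)=\sum_{k+|\alpha|=r}c_{k,\alpha}\partial_t^k\partial_x^\alpha$ with constant coefficients and $c_{r,0}>0$; its symbol is $P_r(\lambda,\xi)=\sum_{k+|\alpha|=r}c_{k,\alpha}\lambda^k\xi^\alpha$, and $P_r(\lambda,i\xi)$ denotes the symbol with $\xi$ replaced by $i\xi$. It is hyperbolic if, for every $\xi'\in S^{n-1}=\{\xi\in\mathbb{R}^n:|\xi|=1\}$, the polynomial $\lambda\mapsto P_r(\lambda,\xi')$ has only real roots, and strictly hyperbolic if in addition these roots are distinct for every $\xi'$. If $p_{r-1}$, $p_r$ are polynomials of degree $r-1$, $r$ with real roots $\tilde\lambda_1\le\dots\le\tilde\lambda_{r-1}$ and $\lambda_1\le\dots\le\lambda_r$ (with multiplicity), they interlace if $\lambda_1\le\tilde\lambda_1\le\lambda_2\le\dots\le\tilde\lambda_{r-1}\le\lambda_r$. For $\xi'\in S^{n-1}$, $a_1(\xi')\le\dots\le a_m(\xi')$ and $b_1(\xi')\le\dots\le b_{m-1}(\xi')$ are the roots of $P_m(\lambda,\xi')$ and $P_{m-1}(\lambda,\xi')$. As polynomials in $\lambda$: $\check P_{m,j}(\lambda,\xi')=P_m(\lambda,\xi')/(\lambda-a_j(\xi'))$, $\check P_{m,j,j+1}(\lambda,\xi')=P_m(\lambda,\xi')/\big((\lambda-a_j(\xi'))(\lambda-a_{j+1}(\xi'))\big)$, $\check P_{m-1,j}(\lambda,\xi')=P_{m-1}(\lambda,\xi')/(\lambda-b_j(\xi'))$.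 The case distinction and the expansions are for given $\xi'\in S^{n-1}$, with $\xi=|\xi|\xi'$ and $|\xi|\to\infty$. *)

theory Defs
  imports
    "HOL-Analysis.Analysis"
    "HOL-Computational_Algebra.Computational_Algebra"
    "HOL-Library.Landau_Symbols"
begin

text \<open>
  A homogeneous operator of order \<open>r\<close> is given by its constant coefficients \<open>c k \<alpha>\<close>; a multi-index
  is a function \<open>\<alpha> :: 'n \<Rightarrow> nat\<close>, and only the entries with \<open>k + |\<alpha>| = r\<close> matter.  The coefficients
  may be complex.  The symbol is a polynomial in \<open>\<lambda>\<close> for each fixed \<open>\<zeta>\<close>; \<open>\<zeta>\<close> ranges over complex
  vectors so that \<open>P(\<lambda>, \<xi>)\<close> and \<open>P(\<lambda>, i\<xi>)\<close> are instances of the same definition.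
\<close>

definition multi_indices :: "nat \<Rightarrow> (nat \<times> ('n::finite \<Rightarrow> nat)) set" where
  "multi_indices r = {(k, \<alpha>). k + (\<Sum>i\<in>UNIV. \<alpha> i) = r}"

definition symbol :: "nat \<Rightarrow> (nat \<Rightarrow> ('n::finite \<Rightarrow> nat) \<Rightarrow> complex) \<Rightarrow> complex ^ 'n \<Rightarrow> complex poly" where
  "symbol r c \<zeta> = (\<Sum>(k, \<alpha>)\<in>multi_indices r. monom (c k \<alpha> * (\<Prod>i\<in>UNIV. (\<zeta> $ i) ^ \<alpha> i)) k)"

definition cvec :: "real ^ 'n \<Rightarrow> complex ^ 'n" where
  "cvec \<xi> = (\<chi> i. complex_of_real (\<xi> $ i))"

lemma finite_multi_indices: "finite (multi_indices r :: (nat \<times> ('n::finite \<Rightarrow> nat)) set)"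
proof -
  have "multi_indices r \<subseteq> {..r} \<times> (PiE (UNIV :: 'n set) (\<lambda>_. {..r}))"
  proof (rule subsetI)
    fix x :: "nat \<times> ('n \<Rightarrow> nat)"
    assume "x \<in> multi_indices r"
    then obtain k \<alpha> where x: "x = (k, \<alpha>)" and eq: "k + (\<Sum>i\<in>UNIV. \<alpha> i) = r"
      by (auto simp: multi_indices_def)
    have "\<alpha> i \<le> (\<Sum>i\<in>UNIV. \<alpha> i)" for i
      by (rule member_le_sum) auto
    then have "\<alpha> i \<le> r" for i
      using eq by (meson le_add2 order_trans order_eq_refl)
    then show "x \<in> {..r} \<times> (PiE UNIV (\<lambda>_. {..r}))"
      using x eq by auto
  qed
  then show ?thesis
    by (rule finite_subset) (intro finite_cartesian_product finite_PiE; simp)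
qed

lemma poly_symbol:
  "poly (symbol r c \<zeta>) z =
     (\<Sum>(k, \<alpha>)\<in>multi_indices r. c k \<alpha> * z ^ k * (\<Prod>i\<in>UNIV. (\<zeta> $ i) ^ \<alpha> i))"
  unfolding symbol_def poly_sum
  by (intro sum.cong) (auto simp: poly_monom algebra_simps)

definition real_rooted :: "complex poly \<Rightarrow> bool" where
  "real_rooted p \<longleftrightarrow> (\<forall>z. poly p z = 0 \<longrightarrow> z \<in> \<real>)"

text \<open>
  The roots of a real-rooted polynomial, repeated according to multiplicity, in nondecreasing order;
  \<open>nth_root p j\<close> is the \<open>j\<close>-th of them, counting from 1.
\<close>

definition ordered_roots :: "complex poly \<Rightarrow> real list" where
  "ordered_roots p = sorted_list_of_multiset (image_mset Re (proots p))"

definition nth_root :: "complex poly \<Rightarrow> nat \<Rightarrow> real" where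
  "nth_root p j = ordered_roots p ! (j - 1)"

definition hyperbolic :: "nat \<Rightarrow> (nat \<Rightarrow> ('n::finite \<Rightarrow> nat) \<Rightarrow> complex) \<Rightarrow> bool" where
  "hyperbolic r c \<longleftrightarrow> (\<forall>\<xi>\<in>sphere 0 1. real_rooted (symbol r c (cvec \<xi>)))"

definition strictly_hyperbolic :: "nat \<Rightarrow> (nat \<Rightarrow> ('n::finite \<Rightarrow> nat) \<Rightarrow> complex) \<Rightarrow> bool" where
  "strictly_hyperbolic r c \<longleftrightarrow>
     hyperbolic r c \<and> (\<forall>\<xi>\<in>sphere 0 1. distinct (ordered_roots (symbol r c (cvec \<xi>))))"

definition interlace :: "complex poly \<Rightarrow> complex poly \<Rightarrow> bool" where
  "interlace q p \<longleftrightarrow>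
     degree p = degree q + 1 \<and> real_rooted q \<and> real_rooted p \<and>
     (\<forall>j\<in>{1..degree q}. nth_root p j \<le> nth_root q j \<and> nth_root q j \<le> nth_root p (j + 1))"

text \<open>Polynomial division, exact here because the divisor collects roots of \<open>p\<close> with multiplicity.\<close>

definition check1 :: "complex poly \<Rightarrow> nat \<Rightarrow> complex poly" where
  "check1 p j = p div [:- complex_of_real (nth_root p j), 1:]"

definition check2 :: "complex poly \<Rightarrow> nat \<Rightarrow> complex poly" where
  "check2 p j = p div ([:- complex_of_real (nth_root p j), 1:] *
                       [:- complex_of_real (nth_root p (j + 1)), 1:])"

text \<open>
  With \<open>q\<close> in the role of \<open>P\<^sub>m\<^sub>-\<^sub>1\<close> and \<open>p\<close> in the role of \<open>P\<^sub>m\<close>.  If \<open>q\<close> has simple roots, the two cases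
  exclude each other.  If moreover \<open>q\<close> and \<open>p\<close> interlace and the \<open>j\<close>-th root of \<open>p\<close> is a simple root
  of \<open>p\<close> and a root of \<open>q\<close>, one of them occurs; then the last branch means that the \<open>j\<close>-th roots agree.
\<close>

definition tilde :: "complex poly \<Rightarrow> complex poly \<Rightarrow> nat \<Rightarrow> complex poly" where
  "tilde q p j = (if 2 \<le> j \<and> nth_root p j = nth_root q (j - 1) then check1 q (j - 1) else check1 q j)"

end

theory Submission
  imports Defs
begin

text \<open>
  On the ray \<open>\<xi> = \<rho> \<xi>'\<close> put \<open>\<lambda> = i \<rho> \<mu>\<close> and \<open>\<epsilon> = 1 / (i \<rho>)\<close>. By homogeneity, \<open>\<lambda>\<close> is a root of
  \<open>Q\<^sub>2(\<lambda>, i \<xi>)\<close> iff \<open>\<mu>\<close> is a root of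
  \<open>p\<^sub>m + \<epsilon> p\<^sub>m\<^sub>-\<^sub>1 + \<epsilon>\<^sup>2 p\<^sub>m\<^sub>-\<^sub>2\<close>, where the \<open>p\<^sub>k\<close> are the symbols at the fixed direction \<open>\<xi>'\<close>
  (\<open>homogeneous_factorization\<close>). So the statement concerns one polynomial \<open>p\<^sub>m\<close> in one variable
  under a small perturbation, and the direction \<open>\<xi>'\<close> is a mere parameter.

  The roots of the perturbed polynomial can be labelled so that they converge to those of \<open>p\<^sub>m\<close>
  (\<open>roots_tendsto\<close>). Interlacing with \<open>p\<^sub>m\<^sub>-\<^sub>1\<close>, whose roots are simple, implies that each root \<open>a\<close> of \<open>p\<^sub>m\<close>
  is at most double and that a double one is also a root of \<open>p\<^sub>m\<^sub>-\<^sub>1\<close> (\<open>no_triple_root\<close>,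
  \<open>interlace_equal_neighbours\<close>). At a simple root, solving the equation for \<open>\<mu> - a\<close> and inserting
  \<open>\<mu> \<rightarrow> a\<close> yields the expansions (\<open>simple_root_first_order\<close>, \<open>common_simple_root_third_order\<close>).
  At a double root the equation is homogeneous of degree two in \<open>(\<mu> - a, \<epsilon>)\<close> to leading order; the two
  quotients \<open>(\<mu> - a) / \<epsilon>\<close> are the roots of a monic quadratic that converges to the normalised equation
  for \<open>\<kappa>\<close>. Knowing that each quotient accumulates at the solutions would not exclude that both approach
  the same one of two distinct solutions; convergence of the whole quadratic does, and continuity of roots, now for
  degree two, supplies the labels (\<open>double_root_pair\<close>).
\<close>

section \<open>Continuity of roots\<close>

lemma linear_factor_quotient:
  fixes p :: "complex poly"
  assumes "degree p = Suc n" "lead_coeff p = 1" "poly p z = 0"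
  obtains q where "p = [:- z, 1:] * q" "degree q = n" "lead_coeff q = 1"
proof -
  from assms(3) obtain q where q: "p = [:- z, 1:] * q"
    by (auto simp: poly_eq_0_iff_dvd)
  with assms(1) have "q \<noteq> 0" by auto
  then have "degree p = Suc (degree q)"
    unfolding q by (subst degree_mult_eq) auto
  moreover have "lead_coeff p = lead_coeff q"
    unfolding q lead_coeff_mult by simp
  ultimately show thesis
    using that[OF q] assms by simp
qed

text \<open>
  The modulus of a monic polynomial at \<open>w\<close> is the product of the distances from \<open>w\<close> to its roots, so
  the nearest root is within the corresponding geometric mean. This quantitative form replaces
  Rouche's theorem in the proof that roots depend continuously on the coefficients.
\<close>
lemma exists_root_near:
  fixes p :: "complex poly"
  assumes "degree p = Suc n" "lead_coeff p = 1"
  shows "\<exists>z. poly p z = 0 \<and> norm (w - z) ^ Suc n \<le> norm (poly p w)"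
  using assms
proof (induction n arbitrary: p)
  case (0 p)
  then obtain z where z: "poly p z = 0"
    using alg_closed_imp_poly_has_root[of p] by auto
  obtain q where q: "p = [:- z, 1:] * q" "degree q = 0" "lead_coeff q = 1"
    using linear_factor_quotient[OF 0 z] .
  then have "q = 1"
    by (metis degree_eq_zeroE lead_coeff_pCons(2) one_pCons)
  with q z show ?case by auto
next
  case (Suc n p)
  then obtain z where z: "poly p z = 0"
    using alg_closed_imp_poly_has_root[of p] by auto
  obtain q where q: "p = [:- z, 1:] * q" "degree q = Suc n" "lead_coeff q = 1"
    using linear_factor_quotient[OF Suc.prems z] .
  obtain z' where z': "poly q z' = 0" "norm (w - z') ^ Suc n \<le> norm (poly q w)"
    using Suc.IH[OF q(2,3)] by blast
  have root: "poly p z' = 0"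
    using z' q by simp
  have val: "norm (poly p w) = norm (w - z) * norm (poly q w)"
    by (simp add: q(1) algebra_simps flip: norm_mult)
  show ?case
  proof (cases "norm (w - z) \<le> norm (w - z')")
    case True
    have "norm (w - z) ^ Suc (Suc n) \<le> norm (w - z) * norm (w - z') ^ Suc n"
      using power_mono[OF True, of "Suc n"] by (simp add: mult_left_mono)
    also have "\<dots> \<le> norm (poly p w)"
      unfolding val using z'(2) by (intro mult_left_mono) auto
    finally show ?thesis using z by blast
  next
    case False
    then have "norm (w - z') ^ Suc (Suc n) \<le> norm (w - z) * norm (w - z') ^ Suc n"
      by (simp add: mult_right_mono)
    also have "\<dots> \<le> norm (poly p w)"
      unfolding val using z'(2) by (intro mult_left_mono) auto
    finally show ?thesis using root by blast
  qed
qed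

lemma tendsto_poly_coeffs:
  fixes p :: "'a \<Rightarrow> complex poly"
  assumes deg: "\<And>t. degree (p t) \<le> N" "degree p0 \<le> N"
    and lim: "\<And>k. ((\<lambda>t. coeff (p t) k) \<longlongrightarrow> coeff p0 k) F"
  shows "((\<lambda>t. poly (p t) z) \<longlongrightarrow> poly p0 z) F"
proof -
  have eq: "poly q z = (\<Sum>k\<le>N. coeff q k * z ^ k)" if "degree q \<le> N" for q :: "complex poly"
    unfolding poly_altdef using that
    by (intro sum.mono_neutral_left) (auto simp: coeff_eq_0)
  show ?thesis
    unfolding eq[OF deg(1)] eq[OF deg(2)] by (intro tendsto_intros lim)
qed

text \<open>
  Synthetic division computes the coefficients of the quotient from the top down, each from the next
  higher one by an expression that is continuous in the data, so convergence propagates downwards.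
\<close>
lemma tendsto_coeff_quotient:
  fixes q :: "'a \<Rightarrow> complex poly"
  assumes deg: "\<And>t. degree (q t) \<le> N" "degree q0 \<le> N"
    and lim: "\<And>k. ((\<lambda>t. coeff ([:- \<mu> t, 1:] * q t) k) \<longlongrightarrow> coeff ([:- x, 1:] * q0) k) F"
    and \<mu>: "(\<mu> \<longlongrightarrow> x) F"
  shows "((\<lambda>t. coeff (q t) k) \<longlongrightarrow> coeff q0 k) F"
proof (cases "k \<le> Suc N")
  case True
  then show ?thesis
  proof (induction rule: inc_induct)
    case base
    then show ?case using deg by (auto simp: coeff_eq_0 le_imp_less_Suc)
  next
    case (step k)
    have "((\<lambda>t. coeff ([:- \<mu> t, 1:] * q t) (Suc k) + \<mu> t * coeff (q t) (Suc k))
        \<longlongrightarrow> coeff ([:- x, 1:] * q0) (Suc k) + x * coeff q0 (Suc k)) F"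
      by (intro tendsto_intros lim \<mu> step.IH)
    then show ?case by simp
  qed
next
  case False
  then have "N < k" by simp
  then have "degree (q t) < k" "degree q0 < k" for t
    using deg le_less_trans by blast+
  then show ?thesis
    by (simp add: coeff_eq_0)
qed

lemma degree_prod_linear:
  "degree (\<Prod>j\<in>J. [:- x j, 1 :: complex:]) = card J"
  by (subst degree_prod_eq_sum_degree) auto

lemma proots_prod_linear:
  assumes "finite J"
  shows "proots (\<Prod>j\<in>J. [:- f j, 1:]) = image_mset f (mset_set J)"
  using assms
proof (induction J rule: finite_induct)
  case (insert i J)
  have "proots ([:- f i, 1:] * (\<Prod>j\<in>J. [:- f j, 1:])) = {#f i#} + proots (\<Prod>j\<in>J. [:- f j, 1:])"
    using insert.hyps by (subst proots_mult) auto
  with insert show ?case by (simp del: mult_pCons_left)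
qed auto

lemma mset_indexed_by:
  assumes "finite J" "size M = card J"
  shows "\<exists>f. M = image_mset f (mset_set J)"
  using assms
proof (induction J arbitrary: M rule: finite_induct)
  case (insert i J)
  then obtain a N where M: "M = add_mset a N"
    by (metis card_insert_disjoint size_eq_Suc_imp_eq_union)
  with insert.prems insert.hyps obtain f where f: "N = image_mset f (mset_set J)"
    using insert.IH[of N] by auto
  have "image_mset (f(i := a)) (mset_set J) = image_mset f (mset_set J)"
    using insert.hyps by (intro image_mset_cong) auto
  with insert.hyps f M show ?case
    by (intro exI[of _ "f(i := a)"]) (simp del: fun_upd_apply add: fun_upd_same)
qed auto

text \<open>
  Roots and labels are matched one at a time: some root of \<open>p t\<close> is near \<open>x i\<close> because \<open>p t\<close> is
  small there, and the other roots are those of the quotient, whose coefficients converge again.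
  Labels range over an arbitrary finite set, so that the same fact serves the whole set of
  characteristic roots and, later, a single pair of them.
\<close>
lemma roots_tendsto:
  fixes p :: "'a \<Rightarrow> complex poly"
  assumes "finite J"
    and "\<And>t. degree (p t) = card J" "\<And>t. lead_coeff (p t) = 1"
    and "\<And>k. ((\<lambda>t. coeff (p t) k) \<longlongrightarrow> coeff (\<Prod>j\<in>J. [:- x j, 1:]) k) F"
  shows "\<exists>\<mu>. (\<forall>t. p t = (\<Prod>j\<in>J. [:- \<mu> j t, 1:])) \<and> (\<forall>j\<in>J. (\<mu> j \<longlongrightarrow> x j) F)"
  using assms
proof (induction J arbitrary: p rule: finite_induct)
  case (empty p)
  then have "p t = 1" for t
    by (metis card.empty degree_eq_zeroE lead_coeff_pCons(2) one_pCons degree_pCons_0 coeff_pCons_0)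
  then show ?case by simp
next
  case (insert i J p)
  define p0 where "p0 = (\<Prod>j\<in>insert i J. [:- x j, 1:])"
  have deg: "degree (p t) = Suc (card J)" for t
    using insert.prems(1)[of t] insert.hyps by simp
  have "\<forall>t. \<exists>z. poly (p t) z = 0 \<and> norm (x i - z) ^ Suc (card J) \<le> norm (poly (p t) (x i))"
    using exists_root_near[OF deg insert.prems(2)] by blast
  then obtain z where z: "\<And>t. poly (p t) (z t) = 0"
    "\<And>t. norm (x i - z t) ^ Suc (card J) \<le> norm (poly (p t) (x i))"
    by metis
  have "((\<lambda>t. poly (p t) (x i)) \<longlongrightarrow> poly p0 (x i)) F"
    using insert.prems(1,3) degree_prod_linear[of x "insert i J"]
    by (intro tendsto_poly_coeffs[of _ "card (insert i J)"]) (auto simp: p0_def)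
  moreover have "poly p0 (x i) = 0"
    using insert.hyps by (simp add: p0_def)
  ultimately have "((\<lambda>t. norm (poly (p t) (x i))) \<longlongrightarrow> 0) F"
    by (simp add: tendsto_norm_zero)
  then have "((\<lambda>t. norm (x i - z t) ^ Suc (card J)) \<longlongrightarrow> 0) F"
    by (rule Lim_null_comparison[rotated]) (use z(2) in auto)
  then have "((\<lambda>t. x i - z t) \<longlongrightarrow> 0) F"
    by (subst (asm) power_tendsto_0_iff) (auto simp: tendsto_norm_zero_iff)
  then have zlim: "(z \<longlongrightarrow> x i) F"
    using tendsto_diff[OF tendsto_const[of "x i"], of "\<lambda>t. x i - z t" 0] by simp
  have "\<forall>t. \<exists>q. p t = [:- z t, 1:] * q \<and> degree q = card J \<and> lead_coeff q = 1"
    using linear_factor_quotient[OF deg insert.prems(2) z(1)] by metis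
  then obtain q where q: "\<And>t. p t = [:- z t, 1:] * q t" "\<And>t. degree (q t) = card J"
    "\<And>t. lead_coeff (q t) = 1"
    by metis
  have "((\<lambda>t. coeff (q t) k) \<longlongrightarrow> coeff (\<Prod>j\<in>J. [:- x j, 1:]) k) F" for k
  proof (rule tendsto_coeff_quotient[OF _ _ _ zlim, of _ "card J"])
    show "((\<lambda>t. coeff ([:- z t, 1:] * q t) k) \<longlongrightarrow>
        coeff ([:- x i, 1:] * (\<Prod>j\<in>J. [:- x j, 1:])) k) F" for k
      using insert.prems(3)[of k] insert.hyps by (simp add: q(1))
  qed (simp_all add: q(2) degree_prod_linear)
  from insert.IH[OF q(2,3) this] obtain \<mu> where
    \<mu>: "\<And>t. q t = (\<Prod>j\<in>J. [:- \<mu> j t, 1:])" "\<And>j. j \<in> J \<Longrightarrow> (\<mu> j \<longlongrightarrow> x j) F"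
    by blast
  have "p t = (\<Prod>j\<in>insert i J. [:- (\<mu>(i := z)) j t, 1:])" for t
  proof -
    have "(\<Prod>j\<in>J. [:- (\<mu>(i := z)) j t, 1:]) = (\<Prod>j\<in>J. [:- \<mu> j t, 1:])"
      using insert.hyps by (intro prod.cong) auto
    then show ?thesis
      using insert.hyps by (simp add: q(1) \<mu>(1))
  qed
  moreover have "((\<mu>(i := z)) j \<longlongrightarrow> x j) F" if "j \<in> insert i J" for j
    using that \<mu>(2) zlim by auto
  ultimately show ?case by blast
qed

section \<open>Expansion at simple roots\<close>

text \<open>
  Dividing \<open>(\<mu> - a) p'(\<mu>) = - \<epsilon> (q(\<mu>) + \<epsilon> r(\<mu>))\<close> by \<open>\<epsilon> p'(\<mu>)\<close> expresses the difference quotient as a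
  continuous function of \<open>\<mu>\<close> and \<open>\<epsilon>\<close>.
\<close>
lemma simple_root_first_order:
  fixes p q r p' :: "complex poly" and \<epsilon> \<mu> :: "'a \<Rightarrow> complex"
  assumes p: "p = [:- a, 1:] * p'" and nz: "poly p' a \<noteq> 0"
    and \<epsilon>: "(\<epsilon> \<longlongrightarrow> 0) F" "\<forall>\<^sub>F t in F. \<epsilon> t \<noteq> 0"
    and \<mu>: "(\<mu> \<longlongrightarrow> a) F"
    and root: "\<forall>\<^sub>F t in F. poly (p + smult (\<epsilon> t) q + smult ((\<epsilon> t)\<^sup>2) r) (\<mu> t) = 0"
  shows "((\<lambda>t. (\<mu> t - a) / \<epsilon> t) \<longlongrightarrow> - poly q a / poly p' a) F"
proof -
  have lim: "((\<lambda>t. poly f (\<mu> t)) \<longlongrightarrow> poly f a) F" for f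
    using \<mu> by (rule tendsto_poly)
  have "((\<lambda>t. - (poly q (\<mu> t) + \<epsilon> t * poly r (\<mu> t)) / poly p' (\<mu> t))
      \<longlongrightarrow> - (poly q a + 0 * poly r a) / poly p' a) F"
    by (intro tendsto_intros lim \<epsilon> nz)
  moreover have "\<forall>\<^sub>F t in F. poly p' (\<mu> t) \<noteq> 0"
    using tendsto_imp_eventually_ne[OF lim nz] .
  then have "\<forall>\<^sub>F t in F. - (poly q (\<mu> t) + \<epsilon> t * poly r (\<mu> t)) / poly p' (\<mu> t) = (\<mu> t - a) / \<epsilon> t"
    using \<epsilon>(2) root
  proof eventually_elim
    case (elim t)
    have "(\<mu> t - a) * poly p' (\<mu> t) + \<epsilon> t * (poly q (\<mu> t) + \<epsilon> t * poly r (\<mu> t)) = 0"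
      using elim(3) by (simp add: p algebra_simps power2_eq_square)
    then show ?case
      using elim(1,2) by (simp add: field_simps eq_neg_iff_add_eq_0 add_eq_0_iff)
  qed
  ultimately show ?thesis
    by (simp add: tendsto_cong)
qed

text \<open>
  At a common root the equation becomes \<open>(\<mu> - a) (p'(\<mu>) + \<epsilon> q'(\<mu>)) = - \<epsilon>\<^sup>2 r(\<mu>)\<close>. The first-order
  result gives \<open>\<mu> - a = o(\<epsilon>)\<close>, so replacing \<open>r(\<mu>)\<close>, \<open>p'(\<mu>)\<close> by their values at \<open>a\<close> costs only \<open>o(\<epsilon>)\<close>,
  and \<open>- \<epsilon>\<^sup>2 r(a) / (p'(a) + \<epsilon> q'(a))\<close> is then expanded to order \<open>\<epsilon>\<^sup>3\<close>.
\<close>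
lemma common_simple_root_third_order:
  fixes p q r p' q' :: "complex poly" and \<epsilon> \<mu> :: "'a \<Rightarrow> complex"
  assumes p: "p = [:- a, 1:] * p'" and q: "q = [:- a, 1:] * q'" and nz: "poly p' a \<noteq> 0"
    and \<epsilon>: "(\<epsilon> \<longlongrightarrow> 0) F" "\<forall>\<^sub>F t in F. \<epsilon> t \<noteq> 0"
    and \<mu>: "(\<mu> \<longlongrightarrow> a) F"
    and root: "\<forall>\<^sub>F t in F. poly (p + smult (\<epsilon> t) q + smult ((\<epsilon> t)\<^sup>2) r) (\<mu> t) = 0"
  shows "((\<lambda>t. ((\<mu> t - a) + (\<epsilon> t)\<^sup>2 * (poly r a / poly p' a)
            - (\<epsilon> t) ^ 3 * (poly r a * poly q' a / (poly p' a)\<^sup>2)) / (\<epsilon> t) ^ 3) \<longlongrightarrow> 0) F"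
proof -
  define c d e where "c = poly p' a" and "d = poly q' a" and "e = poly r a"
  note cde [symmetric] = c_def d_def e_def
  have c: "c \<noteq> 0" using nz by (simp add: c_def)
  have first_order: "((\<lambda>t. (\<mu> t - a) / \<epsilon> t) \<longlongrightarrow> 0) F"
    using simple_root_first_order[OF p nz \<epsilon> \<mu> root] by (simp add: q)
  have diff: "((\<lambda>t. (poly f (\<mu> t) - poly f a) / \<epsilon> t) \<longlongrightarrow> 0) F" for f
  proof -
    obtain g where g: "f - [:poly f a:] = [:- a, 1:] * g"
      by (metis dvdE poly_eq_0_iff_dvd poly_diff poly_pCons poly_0 mult_zero_right add_0_right diff_self)
    have "poly f z - poly f a = (z - a) * poly g z" for z
      using arg_cong[OF g, of "\<lambda>h. poly h z"] by (simp add: algebra_simps)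
    moreover have "((\<lambda>t. ((\<mu> t - a) / \<epsilon> t) * poly g (\<mu> t)) \<longlongrightarrow> 0 * poly g a) F"
      by (intro tendsto_intros first_order tendsto_poly \<mu>)
    ultimately show ?thesis by simp
  qed
  \<comment> \<open>the factor multiplying \<open>\<mu> - a\<close>; its difference quotient produces the term with \<open>q'\<close>\<close>
  define s where "s = (\<lambda>t. poly p' (\<mu> t) + \<epsilon> t * poly q' (\<mu> t))"
  have s_lim: "(s \<longlongrightarrow> c) F"
    unfolding s_def using tendsto_add[OF tendsto_poly[OF \<mu>] tendsto_mult[OF \<epsilon>(1) tendsto_poly[OF \<mu>]], of p' q']
    by (simp add: cde)
  have s_diff: "((\<lambda>t. (s t - c) / \<epsilon> t) \<longlongrightarrow> d) F"
  proof (rule Lim_transform_eventually)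
    show "((\<lambda>t. (poly p' (\<mu> t) - poly p' a) / \<epsilon> t + poly q' (\<mu> t)) \<longlongrightarrow> d) F"
      using tendsto_add[OF diff tendsto_poly[OF \<mu>], of p' q'] by (simp add: cde)
    show "\<forall>\<^sub>F t in F. (poly p' (\<mu> t) - poly p' a) / \<epsilon> t + poly q' (\<mu> t) = (s t - c) / \<epsilon> t"
      using \<epsilon>(2) by eventually_elim (simp add: s_def c_def field_simps)
  qed
  have "((\<lambda>t. - ((poly r (\<mu> t) - poly r a) / \<epsilon> t) / s t + e * ((s t - c) / \<epsilon> t) / (c * s t) - e * d / c\<^sup>2)
      \<longlongrightarrow> - 0 / c + e * d / (c * c) - e * d / c\<^sup>2) F"
    using c by (intro tendsto_intros diff s_lim s_diff) auto
  then have lim: "((\<lambda>t. - ((poly r (\<mu> t) - poly r a) / \<epsilon> t) / s t + e * ((s t - c) / \<epsilon> t) / (c * s t) - e * d / c\<^sup>2)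
      \<longlongrightarrow> 0) F"
    by (simp add: power2_eq_square)
  show ?thesis
    unfolding cde
  proof (rule Lim_transform_eventually[OF lim[unfolded cde]])
    have "\<forall>\<^sub>F t in F. s t \<noteq> 0"
      using tendsto_imp_eventually_ne[OF s_lim c] .
    then show "\<forall>\<^sub>F t in F. - ((poly r (\<mu> t) - e) / \<epsilon> t) / s t + e * ((s t - c) / \<epsilon> t) / (c * s t) - e * d / c\<^sup>2
        = ((\<mu> t - a) + (\<epsilon> t)\<^sup>2 * (e / c) - (\<epsilon> t) ^ 3 * (e * d / c\<^sup>2)) / (\<epsilon> t) ^ 3"
      using \<epsilon>(2) root
    proof eventually_elim
      case (elim t)
      have "(\<mu> t - a) * s t + (\<epsilon> t)\<^sup>2 * poly r (\<mu> t) = 0"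
        using elim(3) by (simp add: p q s_def algebra_simps)
      then have \<delta>: "\<mu> t - a = - ((\<epsilon> t)\<^sup>2 * poly r (\<mu> t)) / s t"
        using elim(1) by (simp add: eq_divide_eq add_eq_0_iff)
      show ?case
        unfolding \<delta> using elim(1,2) c by (simp add: field_simps power2_eq_square power3_eq_cube)
    qed
  qed
qed

section \<open>Splitting of double roots\<close>

lemma mult_linear_factors:
  "[:- u, 1:] * [:- v, 1:] = [:u * v, - (u + v), 1 :: complex:]"
  by simp

lemma quadratic_factorization:
  fixes c d e :: complex
  assumes "c \<noteq> 0"
  obtains u v where "[:e, d, c:] = smult c ([:- u, 1:] * [:- v, 1:])"
proof -
  have "size (proots [:e, d, c:]) = 2"
    using assms by (simp add: size_proots_complex)
  then obtain u v where "proots [:e, d, c:] = {#u, v#}"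
  proof -
    obtain u M where M: "proots [:e, d, c:] = add_mset u M" "size M = Suc 0"
      using \<open>size _ = 2\<close> by (metis numeral_2_eq_2 size_eq_Suc_imp_eq_union size_add_mset nat.inject)
    then obtain v where "M = {#v#}"
      by (metis size_1_singleton_mset One_nat_def)
    with M that show thesis by blast
  qed
  then have "[:e, d, c:] = smult c ([:- u, 1:] * [:- v, 1:])"
    using complex_poly_decompose_multiset[of "[:e, d, c:]"] assms by simp
  then show thesis by (rule that)
qed

text \<open>
  Rescale around \<open>a\<close> by \<open>z = a + \<epsilon> w\<close>. There the perturbed polynomial is \<open>\<epsilon>\<^sup>2\<close> times a perturbation
  of the quadratic \<open>p'(a) w\<^sup>2 + q'(a) w + r(a)\<close>, and the factors of the roots other than \<open>\<mu> i\<close>, \<open>\<mu> i'\<close> tend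
  to \<open>p'(a)\<close>. Hence the monic quadratic with roots \<open>(\<mu> i - a) / \<epsilon>\<close>, \<open>(\<mu> i' - a) / \<epsilon>\<close> converges, and
  continuity of roots applies to it. The pair may have to be exchanged as \<open>t\<close> varies, which is why new
  labels \<open>\<nu>\<close>, \<open>\<nu>'\<close> appear; the argument covers a double root \<open>\<kappa> = \<kappa>'\<close> as well.
\<close>
lemma double_root_pair:
  fixes p q r p' q' :: "complex poly" and \<epsilon> :: "'a \<Rightarrow> complex" and \<mu> :: "'b \<Rightarrow> 'a \<Rightarrow> complex"
  assumes J: "finite J" "i \<in> J" "i' \<in> J" "i \<noteq> i'"
    and x: "x i = a" "x i' = a" and p_x: "p = (\<Prod>j\<in>J. [:- x j, 1:])"
    and p: "p = [:- a, 1:] * [:- a, 1:] * p'" and q: "q = [:- a, 1:] * q'" and nz: "poly p' a \<noteq> 0"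
    and \<epsilon>: "(\<epsilon> \<longlongrightarrow> 0) F" "\<forall>\<^sub>F t in F. \<epsilon> t \<noteq> 0"
    and \<mu>: "\<And>j. j \<in> J \<Longrightarrow> (\<mu> j \<longlongrightarrow> x j) F"
    and factors: "\<forall>\<^sub>F t in F. p + smult (\<epsilon> t) q + smult ((\<epsilon> t)\<^sup>2) r = (\<Prod>j\<in>J. [:- \<mu> j t, 1:])"
  shows "\<exists>\<nu> \<nu>' \<kappa> \<kappa>'. (\<forall>t. [:- \<nu> t, 1:] * [:- \<nu>' t, 1:] = [:- \<mu> i t, 1:] * [:- \<mu> i' t, 1:]) \<and>
    proots [:poly r a, poly q' a, poly p' a:] = {#\<kappa>, \<kappa>'#} \<and>
    ((\<lambda>t. (\<nu> t - a) / \<epsilon> t) \<longlongrightarrow> \<kappa>) F \<and> ((\<lambda>t. (\<nu>' t - a) / \<epsilon> t) \<longlongrightarrow> \<kappa>') F"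
proof -
  obtain \<kappa> \<kappa>' where \<kappa>: "[:poly r a, poly q' a, poly p' a:] = smult (poly p' a) ([:- \<kappa>, 1:] * [:- \<kappa>', 1:])"
    using quadratic_factorization[OF nz] .
  define g g' where "g = (\<lambda>t. (\<mu> i t - a) / \<epsilon> t)" and "g' = (\<lambda>t. (\<mu> i' t - a) / \<epsilon> t)"
  define J' where "J' = J - {i, i'}"
  have split: "(\<Prod>j\<in>J. f j) = f i * f i' * (\<Prod>j\<in>J'. f j)" for f :: "'b \<Rightarrow> complex poly"
  proof -
    have "J = insert i (insert i' J')" "i \<notin> insert i' J'" "i' \<notin> J'" "finite J'"
      using J by (auto simp: J'_def)
    then show ?thesis by (simp only: prod.insert finite_insert not_False_eq_True mult.assoc)
  qed
  have p': "p' = (\<Prod>j\<in>J'. [:- x j, 1:])"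
  proof -
    have "[:- a, 1:] * [:- a, 1:] * p' = [:- a, 1:] * [:- a, 1:] * (\<Prod>j\<in>J'. [:- x j, 1:])"
      using p p_x by (simp only: split x)
    then show ?thesis by (subst (asm) mult_cancel_left) auto
  qed
  have lim: "((\<lambda>t. (w - g t) * (w - g' t)) \<longlongrightarrow> (w - \<kappa>) * (w - \<kappa>')) F" for w
  proof -
    define z where "z = (\<lambda>t. a + \<epsilon> t * w)"
    have z: "(z \<longlongrightarrow> a) F"
      unfolding z_def using tendsto_add[OF tendsto_const tendsto_mult[OF \<epsilon>(1) tendsto_const], of a w] by simp
    define R where "R = (\<lambda>t. \<Prod>j\<in>J'. z t - \<mu> j t)"
    have "(R \<longlongrightarrow> (\<Prod>j\<in>J'. a - x j)) F"
      unfolding R_def by (intro tendsto_intros z \<mu>) (auto simp: J'_def)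
    then have R: "(R \<longlongrightarrow> poly p' a) F"
      by (simp add: p' poly_prod)
    have "((\<lambda>t. (w\<^sup>2 * poly p' (z t) + w * poly q' (z t) + poly r (z t)) / R t)
        \<longlongrightarrow> (w\<^sup>2 * poly p' a + w * poly q' a + poly r a) / poly p' a) F"
      by (intro tendsto_intros tendsto_poly z R nz)
    moreover have "w\<^sup>2 * poly p' a + w * poly q' a + poly r a = poly p' a * ((w - \<kappa>) * (w - \<kappa>'))"
      using arg_cong[OF \<kappa>, of "\<lambda>f. poly f w"] by (simp add: algebra_simps power2_eq_square)
    ultimately have "((\<lambda>t. (w\<^sup>2 * poly p' (z t) + w * poly q' (z t) + poly r (z t)) / R t)
        \<longlongrightarrow> (w - \<kappa>) * (w - \<kappa>')) F"
      using nz by simp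
    then show ?thesis
    proof (rule Lim_transform_eventually)
      have "\<forall>\<^sub>F t in F. R t \<noteq> 0"
        using tendsto_imp_eventually_ne[OF R nz] .
      then show "\<forall>\<^sub>F t in F. (w\<^sup>2 * poly p' (z t) + w * poly q' (z t) + poly r (z t)) / R t
          = (w - g t) * (w - g' t)"
        using \<epsilon>(2) factors
      proof eventually_elim
        case (elim t)
        have "poly (\<Prod>j\<in>J. [:- \<mu> j t, 1:]) (z t) = (z t - \<mu> i t) * (z t - \<mu> i' t) * R t"
          unfolding split R_def poly_mult poly_prod by simp
        moreover have "poly (p + smult (\<epsilon> t) q + smult ((\<epsilon> t)\<^sup>2) r) (z t)
            = (\<epsilon> t)\<^sup>2 * (w\<^sup>2 * poly p' (z t) + w * poly q' (z t) + poly r (z t))"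
          unfolding p q by (simp add: z_def algebra_simps power2_eq_square)
        moreover have "z t - \<mu> i t = \<epsilon> t * (w - g t)" "z t - \<mu> i' t = \<epsilon> t * (w - g' t)"
          using elim(2) by (simp_all add: z_def g_def g'_def field_simps)
        ultimately have "(\<epsilon> t)\<^sup>2 * (w\<^sup>2 * poly p' (z t) + w * poly q' (z t) + poly r (z t))
            = (\<epsilon> t)\<^sup>2 * ((w - g t) * (w - g' t) * R t)"
          unfolding elim(3) by (simp only: power2_eq_square mult_ac)
        then show ?case
          using elim(1,2) by simp
      qed
    qed
  qed
  \<comment> \<open>a monic quadratic is determined by its values at two points; take \<open>0\<close> and \<open>1\<close>\<close>
  have lim_prod: "((\<lambda>t. g t * g' t) \<longlongrightarrow> \<kappa> * \<kappa>') F"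
    using lim[of 0] by simp
  have "((\<lambda>t. (1 - g t) * (1 - g' t) - (0 - g t) * (0 - g' t) - 1) \<longlongrightarrow>
      (1 - \<kappa>) * (1 - \<kappa>') - (0 - \<kappa>) * (0 - \<kappa>') - 1) F"
    by (intro tendsto_intros lim)
  then have lim_sum: "((\<lambda>t. - g' t - g t) \<longlongrightarrow> - \<kappa>' - \<kappa>) F"
    by (simp add: algebra_simps)
  have "\<exists>\<gamma>. (\<forall>t. [:- g t, 1:] * [:- g' t, 1:] = (\<Prod>b\<in>UNIV. [:- \<gamma> b t, 1:])) \<and>
      (\<forall>b\<in>UNIV. (\<gamma> b \<longlongrightarrow> (if b then \<kappa> else \<kappa>')) F)"
  proof (rule roots_tendsto)
    show "((\<lambda>t. coeff ([:- g t, 1:] * [:- g' t, 1:]) k) \<longlongrightarrow>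
        coeff (\<Prod>b\<in>UNIV. [:- (if b then \<kappa> else \<kappa>'), 1:]) k) F" for k
      using lim_prod lim_sum
      by (auto simp: UNIV_bool coeff_pCons mult.commute add.commute split: nat.split)
  qed (auto simp: UNIV_bool)
  then obtain \<gamma> where \<gamma>: "\<And>t. [:- g t, 1:] * [:- g' t, 1:] = [:- \<gamma> True t, 1:] * [:- \<gamma> False t, 1:]"
    and \<gamma>_lim: "(\<gamma> True \<longlongrightarrow> \<kappa>) F" "(\<gamma> False \<longlongrightarrow> \<kappa>') F"
    by (auto simp: UNIV_bool mult.commute)
  define \<nu> \<nu>' where "\<nu> = (\<lambda>t. if \<epsilon> t = 0 then \<mu> i t else a + \<epsilon> t * \<gamma> True t)"
    and "\<nu>' = (\<lambda>t. if \<epsilon> t = 0 then \<mu> i' t else a + \<epsilon> t * \<gamma> False t)"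
  have "[:- \<nu> t, 1:] * [:- \<nu>' t, 1:] = [:- \<mu> i t, 1:] * [:- \<mu> i' t, 1:]" for t
  proof (cases "\<epsilon> t = 0")
    case False
    have "\<mu> i t = a + \<epsilon> t * g t" "\<mu> i' t = a + \<epsilon> t * g' t"
      using False by (simp_all add: g_def g'_def)
    moreover have "g t * g' t = \<gamma> True t * \<gamma> False t" "g t + g' t = \<gamma> True t + \<gamma> False t"
      using \<gamma>[of t] by (auto simp: mult_linear_factors algebra_simps)
    moreover have "(a + \<epsilon> t * u) * (a + \<epsilon> t * v) = a\<^sup>2 + a * \<epsilon> t * (u + v) + (\<epsilon> t)\<^sup>2 * (u * v)"
      "(a + \<epsilon> t * u) + (a + \<epsilon> t * v) = 2 * a + \<epsilon> t * (u + v)" for u v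
      by (simp_all add: algebra_simps power2_eq_square)
    ultimately show ?thesis
      unfolding mult_linear_factors \<nu>_def \<nu>'_def using False by simp
  qed (simp add: \<nu>_def \<nu>'_def)
  moreover have "((\<lambda>t. (\<nu> t - a) / \<epsilon> t) \<longlongrightarrow> \<kappa>) F"
    by (rule Lim_transform_eventually[OF \<gamma>_lim(1)])
      (use \<epsilon>(2) in \<open>eventually_elim, simp add: \<nu>_def\<close>)
  moreover have "((\<lambda>t. (\<nu>' t - a) / \<epsilon> t) \<longlongrightarrow> \<kappa>') F"
    by (rule Lim_transform_eventually[OF \<gamma>_lim(2)])
      (use \<epsilon>(2) in \<open>eventually_elim, simp add: \<nu>'_def\<close>)
  moreover have "proots [:poly r a, poly q' a, poly p' a:] = {#\<kappa>, \<kappa>'#}"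
  proof -
    have "proots ([:- \<kappa>, 1:] * [:- \<kappa>', 1:]) = proots [:- \<kappa>, 1:] + proots [:- \<kappa>', 1:]"
      by (rule proots_mult) auto
    then show ?thesis
      unfolding \<kappa> proots_smult[OF nz] by simp
  qed
  ultimately show ?thesis by blast
qed

lemma prod_remove_two:
  fixes f :: "'b \<Rightarrow> 'c :: comm_monoid_mult"
  assumes "finite A" "i \<in> A" "j \<in> A" "i \<noteq> j"
  shows "prod f A = f i * f j * prod f (A - {i, j})"
proof -
  have "prod f A = f i * (f j * prod f (A - {i} - {j}))"
    using assms prod.remove[of A i f] prod.remove[of "A - {i}" j f] by simp
  also have "A - {i} - {j} = A - {i, j}" by auto
  finally show ?thesis by (simp add: mult.assoc)
qed

text \<open>
  The pairs \<open>{j, j + 1}\<close> with \<open>j \<in> D\<close> are disjoint because \<open>j + 1 \<notin> D\<close>, so the relabellings of the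
  individual double roots do not interfere and can be carried out one after the other.
\<close>
lemma double_roots_labelling:
  fixes p q r :: "complex poly" and p' q' :: "nat \<Rightarrow> complex poly"
    and \<epsilon> :: "'a \<Rightarrow> complex" and \<mu>\<^sub>0 :: "nat \<Rightarrow> 'a \<Rightarrow> complex"
  assumes J: "finite J" and p_x: "p = (\<Prod>j\<in>J. [:- x j, 1:])"
    and \<epsilon>: "(\<epsilon> \<longlongrightarrow> 0) F" "\<forall>\<^sub>F t in F. \<epsilon> t \<noteq> 0"
    and \<mu>\<^sub>0: "\<And>j. j \<in> J \<Longrightarrow> (\<mu>\<^sub>0 j \<longlongrightarrow> x j) F"
      "\<And>t. p + smult (\<epsilon> t) q + smult ((\<epsilon> t)\<^sup>2) r = (\<Prod>j\<in>J. [:- \<mu>\<^sub>0 j t, 1:])"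
    and D: "finite D" "\<And>j. j \<in> D \<Longrightarrow> j \<in> J \<and> Suc j \<in> J \<and> x (Suc j) = x j \<and> Suc j \<notin> D"
    and p: "\<And>j. j \<in> D \<Longrightarrow> p = [:- x j, 1:] * [:- x j, 1:] * p' j"
    and q: "\<And>j. j \<in> D \<Longrightarrow> q = [:- x j, 1:] * q' j"
    and nz: "\<And>j. j \<in> D \<Longrightarrow> poly (p' j) (x j) \<noteq> 0"
  shows "\<exists>\<mu>. (\<forall>t. p + smult (\<epsilon> t) q + smult ((\<epsilon> t)\<^sup>2) r = (\<Prod>j\<in>J. [:- \<mu> j t, 1:])) \<and>
    (\<forall>j\<in>J. (\<mu> j \<longlongrightarrow> x j) F) \<and>
    (\<forall>j\<in>D. \<exists>\<kappa> \<kappa>'. proots [:poly r (x j), poly (q' j) (x j), poly (p' j) (x j):] = {#\<kappa>, \<kappa>'#} \<and>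
      ((\<lambda>t. (\<mu> j t - x j) / \<epsilon> t) \<longlongrightarrow> \<kappa>) F \<and> ((\<lambda>t. (\<mu> (Suc j) t - x j) / \<epsilon> t) \<longlongrightarrow> \<kappa>') F)"
  using D p q nz
proof (induction D rule: finite_induct)
  case empty
  then show ?case using \<mu>\<^sub>0 by auto
next
  case (insert d D)
  obtain \<mu> where factors: "\<And>t. p + smult (\<epsilon> t) q + smult ((\<epsilon> t)\<^sup>2) r = (\<Prod>j\<in>J. [:- \<mu> j t, 1:])"
    and \<mu>: "\<And>j. j \<in> J \<Longrightarrow> (\<mu> j \<longlongrightarrow> x j) F"
    and D: "\<And>j. j \<in> D \<Longrightarrow> \<exists>\<kappa> \<kappa>'. proots [:poly r (x j), poly (q' j) (x j), poly (p' j) (x j):] = {#\<kappa>, \<kappa>'#} \<and>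
      ((\<lambda>t. (\<mu> j t - x j) / \<epsilon> t) \<longlongrightarrow> \<kappa>) F \<and> ((\<lambda>t. (\<mu> (Suc j) t - x j) / \<epsilon> t) \<longlongrightarrow> \<kappa>') F"
    using insert.IH insert.prems by (auto simp del: mult_pCons_left)
  have d: "d \<in> J" "Suc d \<in> J" "x (Suc d) = x d" "Suc d \<notin> D"
    using insert.prems(1)[of d] by auto
  obtain \<nu> \<nu>' \<kappa> \<kappa>' where
    \<nu>: "\<And>t. [:- \<nu> t, 1:] * [:- \<nu>' t, 1:] = [:- \<mu> d t, 1:] * [:- \<mu> (Suc d) t, 1:]"
    and \<kappa>: "proots [:poly r (x d), poly (q' d) (x d), poly (p' d) (x d):] = {#\<kappa>, \<kappa>'#}"
    and lim: "((\<lambda>t. (\<nu> t - x d) / \<epsilon> t) \<longlongrightarrow> \<kappa>) F" "((\<lambda>t. (\<nu>' t - x d) / \<epsilon> t) \<longlongrightarrow> \<kappa>') F"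
    using double_root_pair[OF J d(1,2) _ refl d(3) p_x insert.prems(2)[OF insertI1]
        insert.prems(3)[OF insertI1] insert.prems(4)[OF insertI1] \<epsilon> \<mu> always_eventually[OF allI[OF factors]]]
    by (metis n_not_Suc_n)
  \<comment> \<open>an expansion to first order implies convergence, so the new labels still tend to \<open>x d\<close>\<close>
  have conv: "(f \<longlongrightarrow> x d) F" if "((\<lambda>t. (f t - x d) / \<epsilon> t) \<longlongrightarrow> k) F" for f k
  proof (rule Lim_transform_eventually)
    show "((\<lambda>t. x d + \<epsilon> t * ((f t - x d) / \<epsilon> t)) \<longlongrightarrow> x d) F"
      using tendsto_add[OF tendsto_const tendsto_mult[OF \<epsilon>(1) that], of "x d"] by simp
    show "\<forall>\<^sub>F t in F. x d + \<epsilon> t * ((f t - x d) / \<epsilon> t) = f t"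
      using \<epsilon>(2) by eventually_elim simp
  qed
  define \<mu>' where "\<mu>' = \<mu>(d := \<nu>, Suc d := \<nu>')"
  have "(\<Prod>j\<in>J. [:- \<mu>' j t, 1:]) = (\<Prod>j\<in>J. [:- \<mu> j t, 1:])" for t
  proof -
    define J' where "J' = J - {d, Suc d}"
    have "(\<Prod>j\<in>J. [:- f j t, 1:]) = [:- f d t, 1:] * [:- f (Suc d) t, 1:] * (\<Prod>j\<in>J'. [:- f j t, 1:])"
      for f :: "nat \<Rightarrow> 'a \<Rightarrow> complex"
      unfolding J'_def using J d by (intro prod_remove_two) auto
    moreover have "(\<Prod>j\<in>J'. [:- \<mu>' j t, 1:]) = (\<Prod>j\<in>J'. [:- \<mu> j t, 1:])"
      by (intro prod.cong) (auto simp: \<mu>'_def J'_def)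
    moreover have "[:- \<mu>' d t, 1:] * [:- \<mu>' (Suc d) t, 1:] = [:- \<mu> d t, 1:] * [:- \<mu> (Suc d) t, 1:]"
      using \<nu>[of t] by (simp add: \<mu>'_def)
    ultimately show ?thesis by (simp only:)
  qed
  moreover have "(\<mu>' j \<longlongrightarrow> x j) F" if "j \<in> J" for j
    using \<mu>[OF that] conv[OF lim(1)] conv[OF lim(2)] d(3) by (auto simp: \<mu>'_def)
  moreover have "\<exists>\<kappa> \<kappa>'. proots [:poly r (x j), poly (q' j) (x j), poly (p' j) (x j):] = {#\<kappa>, \<kappa>'#} \<and>
      ((\<lambda>t. (\<mu>' j t - x j) / \<epsilon> t) \<longlongrightarrow> \<kappa>) F \<and> ((\<lambda>t. (\<mu>' (Suc j) t - x j) / \<epsilon> t) \<longlongrightarrow> \<kappa>') F"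
    if "j \<in> insert d D" for j
  proof (cases "j = d")
    case True
    then show ?thesis using \<kappa> lim by (auto simp: \<mu>'_def)
  next
    case False
    with that have j: "j \<in> D" "Suc j \<noteq> d" "j \<noteq> Suc d"
      using insert.prems(1)[of j] d(4) by auto
    then have "\<mu>' j = \<mu> j" "\<mu>' (Suc j) = \<mu> (Suc j)"
      using False by (auto simp: \<mu>'_def)
    with D[OF j(1)] show ?thesis by simp
  qed
  ultimately show ?case
    by (intro exI[of _ \<mu>']) (simp only: factors, blast)
qed

section \<open>Interlacing polynomials\<close>

lemma length_ordered_roots [simp]: "length (ordered_roots p) = degree p"
  by (metis ordered_roots_def mset_sorted_list_of_multiset size_image_mset size_mset size_proots_complex)

lemma proots_eq_mset_ordered_roots:
  assumes "real_rooted p"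
  shows "proots p = mset (map complex_of_real (ordered_roots p))"
proof (cases "p = 0")
  case False
  have "image_mset (\<lambda>z. complex_of_real (Re z)) (proots p) = image_mset (\<lambda>z. z) (proots p)"
    using assms False by (intro image_mset_cong) (auto simp: real_rooted_def complex_is_Real_iff complex_eq_iff)
  then show ?thesis
    by (simp add: ordered_roots_def multiset.map_comp comp_def)
qed (simp add: ordered_roots_def)

lemma nth_root_mono:
  assumes "1 \<le> i" "i \<le> j" "j \<le> degree p"
  shows "nth_root p i \<le> nth_root p j"
proof -
  have "sorted (ordered_roots p)"
    by (simp add: ordered_roots_def)
  with assms show ?thesis
    unfolding nth_root_def by (intro sorted_nth_mono) auto
qed

lemma real_rooted_factorization:
  assumes "real_rooted p"
  shows "p = smult (lead_coeff p) (\<Prod>j\<in>{1..degree p}. [:- complex_of_real (nth_root p j), 1:])"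
proof -
  have "{1..degree p} = Suc ` {0..<degree p}"
    by (simp add: image_Suc_atLeastLessThan atLeastLessThanSuc_atLeastAtMost)
  then have "(\<Prod>j\<in>{1..degree p}. [:- complex_of_real (nth_root p j), 1:]) =
      (\<Prod>i\<in>{0..<degree p}. [:- complex_of_real (ordered_roots p ! i), 1:])"
    by (intro prod.reindex_cong[of Suc]) (auto simp: nth_root_def)
  also have "\<dots> = prod_list (map (\<lambda>z. [:- z, 1:]) (map complex_of_real (ordered_roots p)))"
    by (subst prod.list_conv_set_nth) simp
  also have "\<dots> = (\<Prod>z\<in>#proots p. [:- z, 1:])"
    unfolding proots_eq_mset_ordered_roots[OF assms] by (simp flip: prod_mset_prod_list mset_map add: comp_def)
  finally show ?thesis
    by (simp add: complex_poly_decompose_multiset)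
qed

lemma real_rooted_root_iff:
  assumes "real_rooted p" "p \<noteq> 0"
  shows "poly p z = 0 \<longleftrightarrow> (\<exists>j\<in>{1..degree p}. z = complex_of_real (nth_root p j))"
  by (subst real_rooted_factorization[OF assms(1)]) (use assms(2) in \<open>simp add: poly_prod\<close>)

lemma check1_factorization:
  assumes "real_rooted p" "j \<in> {1..degree p}"
  shows "p = [:- complex_of_real (nth_root p j), 1:] * check1 p j"
    and "poly (check1 p j) z = lead_coeff p * (\<Prod>k\<in>{1..degree p} - {j}. z - complex_of_real (nth_root p k))"
proof -
  let ?f = "\<lambda>k. [:- complex_of_real (nth_root p k), 1:]"
  have "p = ?f j * smult (lead_coeff p) (\<Prod>k\<in>{1..degree p} - {j}. ?f k)"
    using real_rooted_factorization[OF assms(1)] prod.remove[OF _ assms(2), of ?f] by (metis finite_atLeastAtMost mult_smult_right)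
  moreover from this have "check1 p j = smult (lead_coeff p) (\<Prod>k\<in>{1..degree p} - {j}. ?f k)"
    unfolding check1_def by (metis nonzero_mult_div_cancel_left pCons_eq_0_iff zero_neq_one)
  ultimately show "p = ?f j * check1 p j"
    "poly (check1 p j) z = lead_coeff p * (\<Prod>k\<in>{1..degree p} - {j}. z - complex_of_real (nth_root p k))"
    by (simp_all only: poly_smult poly_prod) simp
qed

lemma check2_factorization:
  assumes "real_rooted p" "1 \<le> j" "Suc j \<le> degree p"
  shows "p = [:- complex_of_real (nth_root p j), 1:] * [:- complex_of_real (nth_root p (Suc j)), 1:] * check2 p j"
    and "poly (check2 p j) z =
      lead_coeff p * (\<Prod>k\<in>{1..degree p} - {j, Suc j}. z - complex_of_real (nth_root p k))"
proof -
  let ?f = "\<lambda>k. [:- complex_of_real (nth_root p k), 1:]" and ?K = "{1..degree p} - {j, Suc j}"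
  have "(\<Prod>k\<in>{1..degree p}. ?f k) = ?f j * ?f (Suc j) * (\<Prod>k\<in>?K. ?f k)"
    using assms by (intro prod_remove_two) auto
  then have p: "p = ?f j * ?f (Suc j) * smult (lead_coeff p) (\<Prod>k\<in>?K. ?f k)"
    using real_rooted_factorization[OF assms(1)] by (simp only: mult_smult_right)
  have "?f j * ?f (Suc j) \<noteq> 0"
    by (simp only: mult_eq_0_iff pCons_eq_0_iff) simp
  from nonzero_mult_div_cancel_left[OF this] have c: "check2 p j = smult (lead_coeff p) (\<Prod>k\<in>?K. ?f k)"
    unfolding check2_def Suc_eq_plus1[symmetric] by (metis p)
  show "p = ?f j * ?f (Suc j) * check2 p j"
    unfolding c by (rule p)
  show "poly (check2 p j) z = lead_coeff p * (\<Prod>k\<in>?K. z - complex_of_real (nth_root p k))"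
    unfolding c poly_smult poly_prod by simp
qed

lemma distinct_nth_root:
  assumes "distinct (ordered_roots p)" "i \<in> {1..degree p}" "j \<in> {1..degree p}"
    and "nth_root p i = nth_root p j"
  shows "i = j"
proof -
  have "i - 1 = j - 1"
    using assms nth_eq_iff_index_eq[of "ordered_roots p" "i - 1" "j - 1"]
    by (auto simp: nth_root_def)
  with assms show ?thesis by auto
qed

lemma interlaceD:
  assumes "interlace q p"
  shows "degree p = Suc (degree q)" "real_rooted q" "real_rooted p"
    and "1 \<le> j \<Longrightarrow> j \<le> degree q \<Longrightarrow> nth_root p j \<le> nth_root q j"
    and "1 \<le> j \<Longrightarrow> j \<le> degree q \<Longrightarrow> nth_root q j \<le> nth_root p (Suc j)"
  using assms by (auto simp: interlace_def)

lemma interlace_equal_neighbours: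
  assumes "interlace q p" "1 \<le> j" "j \<le> degree q" "nth_root p j = nth_root p (Suc j)"
  shows "nth_root q j = nth_root p j"
  using interlaceD(4,5)[OF assms(1-3)] assms(4) by simp

text \<open>
  Between two equal neighbouring roots of \<open>p\<close> interlacing traps a root of \<open>q\<close>. A triple root of \<open>p\<close>
  would trap two of them and make a multiple root of \<open>q\<close>.
\<close>
lemma no_triple_root:
  assumes pq: "interlace q p" and q: "distinct (ordered_roots q)"
    and j: "1 \<le> j" "j \<le> degree q" "nth_root p j = nth_root p (Suc j)"
    and k: "1 \<le> k" "k \<le> degree p" "k \<noteq> j" "k \<noteq> Suc j"
  shows "nth_root p k \<noteq> nth_root p j"
proof
  assume eq: "nth_root p k = nth_root p j"
  note mono = nth_root_mono[of _ _ p] and deg = interlaceD(1)[OF pq]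
  note shared = interlace_equal_neighbours[OF pq]
  consider "k < j" | "Suc j < k" using k by linarith
  then show False
  proof cases
    case 1
    then obtain i where i: "j = Suc i" "k \<le> i" by (cases j) auto
    have "nth_root p k \<le> nth_root p i" "nth_root p i \<le> nth_root p j"
      by (rule mono; use i j k deg in simp)+
    then have "nth_root p i = nth_root p (Suc i)"
      using eq i by simp
    then have "nth_root q i = nth_root q j"
      using shared[of i] shared[of j] i j k by auto
    with distinct_nth_root[OF q, of i j] show False
      using i j k by auto
  next
    case 2
    have "nth_root p (Suc (Suc j)) \<le> nth_root p k" "nth_root p (Suc j) \<le> nth_root p (Suc (Suc j))"
      by (rule mono; use 2 j k deg in auto)+
    then have "nth_root p (Suc j) = nth_root p (Suc (Suc j))"
      using eq j by simp
    then have "nth_root q j = nth_root q (Suc j)"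
      using shared[of j] shared[of "Suc j"] 2 j k deg by auto
    with distinct_nth_root[OF q, of j "Suc j"] show False
      using 2 j k deg by auto
  qed
qed

text \<open>
  Interlacing leaves only the neighbours \<open>j - 1\<close> and \<open>j\<close> as possible indices of a root of \<open>q\<close> equal to
  the \<open>j\<close>-th root of \<open>p\<close>: any other index would force a second root of \<open>p\<close> to coincide with it.
\<close>
lemma tilde_factorization:
  assumes pq: "interlace q p" and "q \<noteq> 0" and j: "j \<in> {1..degree p}"
    and root: "poly q (of_real (nth_root p j)) = 0"
    and simple: "poly (check1 p j) (of_real (nth_root p j)) \<noteq> 0"
  shows "q = [:- complex_of_real (nth_root p j), 1:] * tilde q p j"
proof -
  note mono = nth_root_mono[of _ _ p] and deg = interlaceD(1)[OF pq]
  have ne: "nth_root p i \<noteq> nth_root p j" if "i \<in> {1..degree p}" "i \<noteq> j" for i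
  proof
    assume "nth_root p i = nth_root p j"
    then have "(\<Prod>k\<in>{1..degree p} - {j}. complex_of_real (nth_root p j) - complex_of_real (nth_root p k)) = 0"
      using that by (intro prod_zero bexI[of _ i]) auto
    with simple check1_factorization(2)[OF interlaceD(3)[OF pq] j] show False by simp
  qed
  obtain k where k: "1 \<le> k" "k \<le> degree q" and eq: "nth_root p j = nth_root q k"
    using root real_rooted_root_iff[OF interlaceD(2)[OF pq] \<open>q \<noteq> 0\<close>] by auto
  note between = interlaceD(4,5)[OF pq k]
  have "k = j \<or> Suc k = j"
  proof (rule ccontr)
    assume "\<not> ?thesis"
    then consider "j < k" | "Suc k < j" by linarith
    then show False
    proof cases
      case 1
      then show False
        using mono[of j k] between eq ne[of k] j k deg by auto
    next
      case 2
      then show False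
        using mono[of "Suc k" j] between eq ne[of "Suc k"] j k deg by auto
    qed
  qed
  then show ?thesis
  proof (cases "2 \<le> j \<and> nth_root p j = nth_root q (j - 1)")
    case True
    then have "j - 1 \<in> {1..degree q}"
      using j deg unfolding atLeastAtMost_iff by linarith
    from check1_factorization(1)[OF interlaceD(2)[OF pq] this] True show ?thesis
      by (simp only: tilde_def) simp
  next
    case False
    with \<open>k = j \<or> Suc k = j\<close> k eq have "k = j" by auto
    then show ?thesis
      using check1_factorization(1)[OF interlaceD(2)[OF pq], of j] False k eq
      by (auto simp: tilde_def)
  qed
qed

text \<open>
  Continuity of roots gives a first labelling, which is then corrected at the double roots. These are
  isolated from each other and from all other roots of \<open>p\<close>, since \<open>p\<close> has no triple roots.
\<close>
lemma interlacing_perturbation_labelling: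
  fixes p q r :: "complex poly" and \<epsilon> :: "'a \<Rightarrow> complex"
  defines "A \<equiv> \<lambda>j. complex_of_real (nth_root p j)"
  assumes pq: "interlace q p" and q: "distinct (ordered_roots q)"
    and monic: "lead_coeff p = 1" and r: "degree r < degree p"
    and \<epsilon>: "(\<epsilon> \<longlongrightarrow> 0) F" "\<forall>\<^sub>F t in F. \<epsilon> t \<noteq> 0"
  shows "\<exists>\<mu>. (\<forall>t. p + smult (\<epsilon> t) q + smult ((\<epsilon> t)\<^sup>2) r = (\<Prod>j\<in>{1..degree p}. [:- \<mu> j t, 1:])) \<and>
    (\<forall>j\<in>{1..degree p}. (\<mu> j \<longlongrightarrow> A j) F) \<and>
    (\<forall>j\<in>{1..degree q}. nth_root p j = nth_root p (Suc j) \<longrightarrow>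
      (\<exists>\<kappa> \<kappa>'. proots [:poly r (A j), poly (check1 q j) (A j), poly (check2 p j) (A j):] = {#\<kappa>, \<kappa>'#} \<and>
        ((\<lambda>t. (\<mu> j t - A j) / \<epsilon> t) \<longlongrightarrow> \<kappa>) F \<and> ((\<lambda>t. (\<mu> (Suc j) t - A j) / \<epsilon> t) \<longlongrightarrow> \<kappa>') F))"
proof -
  note deg = interlaceD(1)[OF pq]
  define f where "f = (\<lambda>t. p + smult (\<epsilon> t) q + smult ((\<epsilon> t)\<^sup>2) r)"
  have p_A: "p = (\<Prod>j\<in>{1..degree p}. [:- A j, 1:])"
    using real_rooted_factorization[OF interlaceD(3)[OF pq]] monic by (simp add: A_def)
  have low: "degree (smult (\<epsilon> t) q + smult ((\<epsilon> t)\<^sup>2) r) < degree p" for t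
    using deg r by (intro degree_add_less) (auto intro: le_less_trans[OF degree_smult_le])
  have f_deg: "degree (f t) = card {1..degree p}" and f_monic: "lead_coeff (f t) = 1" for t
    using degree_add_eq_left[OF low[of t]] monic coeff_eq_0[OF low[of t]]
    by (simp_all add: f_def add.assoc del: coeff_smult)
  have f_lim: "((\<lambda>t. coeff (f t) k) \<longlongrightarrow> coeff (\<Prod>j\<in>{1..degree p}. [:- A j, 1:]) k) F" for k
  proof -
    have "((\<lambda>t. coeff p k + \<epsilon> t * coeff q k + (\<epsilon> t)\<^sup>2 * coeff r k)
        \<longlongrightarrow> coeff p k + 0 * coeff q k + 0\<^sup>2 * coeff r k) F"
      by (intro tendsto_intros \<epsilon>)
    then show ?thesis
      unfolding p_A[symmetric] by (simp add: f_def)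
  qed
  obtain \<mu>\<^sub>0 where \<mu>\<^sub>0: "\<And>t. f t = (\<Prod>j\<in>{1..degree p}. [:- \<mu>\<^sub>0 j t, 1:])"
    "\<And>j. j \<in> {1..degree p} \<Longrightarrow> (\<mu>\<^sub>0 j \<longlongrightarrow> A j) F"
    using roots_tendsto[OF finite_atLeastAtMost f_deg f_monic f_lim] by blast
  define D where "D = {j \<in> {1..degree q}. nth_root p j = nth_root p (Suc j)}"
  have D: "1 \<le> j" "j \<le> degree q" "nth_root p j = nth_root p (Suc j)" if "j \<in> D" for j
    using that by (auto simp: D_def)
  have "\<exists>\<mu>. (\<forall>t. p + smult (\<epsilon> t) q + smult ((\<epsilon> t)\<^sup>2) r = (\<Prod>j\<in>{1..degree p}. [:- \<mu> j t, 1:])) \<and>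
    (\<forall>j\<in>{1..degree p}. (\<mu> j \<longlongrightarrow> A j) F) \<and>
    (\<forall>j\<in>D. \<exists>\<kappa> \<kappa>'. proots [:poly r (A j), poly (check1 q j) (A j), poly (check2 p j) (A j):] = {#\<kappa>, \<kappa>'#} \<and>
      ((\<lambda>t. (\<mu> j t - A j) / \<epsilon> t) \<longlongrightarrow> \<kappa>) F \<and> ((\<lambda>t. (\<mu> (Suc j) t - A j) / \<epsilon> t) \<longlongrightarrow> \<kappa>') F)"
  proof (rule double_roots_labelling[OF finite_atLeastAtMost p_A \<epsilon> \<mu>\<^sub>0(2) \<mu>\<^sub>0(1)[unfolded f_def]])
    show "finite D" by (simp add: D_def)
    fix j assume j: "j \<in> D"
    note j' = D[OF j]
    have "Suc j \<notin> D"
    proof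
      assume "Suc j \<in> D"
      from D[OF this] have "nth_root p (Suc (Suc j)) = nth_root p j" "Suc (Suc j) \<le> degree p"
        using j' deg by auto
      with no_triple_root[OF pq q j', of "Suc (Suc j)"] show False by simp
    qed
    then show "j \<in> {1..degree p} \<and> Suc j \<in> {1..degree p} \<and> A (Suc j) = A j \<and> Suc j \<notin> D"
      using j' deg by (simp add: A_def)
    have j'': "Suc j \<le> degree p" using j' deg by simp
    show "p = [:- A j, 1:] * [:- A j, 1:] * check2 p j"
      using check2_factorization(1)[OF interlaceD(3)[OF pq] j'(1) j''] j'(3) unfolding A_def by (simp only:)
    show "q = [:- A j, 1:] * check1 q j"
      using check1_factorization(1)[OF interlaceD(2)[OF pq], of j] j'
        interlace_equal_neighbours[OF pq j'] unfolding A_def by (simp only: atLeastAtMost_iff)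
    show "poly (check2 p j) (A j) \<noteq> 0"
    proof -
      have "A j - complex_of_real (nth_root p k) \<noteq> 0" if "k \<in> {1..degree p} - {j, Suc j}" for k
        using no_triple_root[OF pq q j', of k] that by (auto simp: A_def)
      then show ?thesis
        unfolding check2_factorization(2)[OF interlaceD(3)[OF pq] j'(1) j''] monic by simp
    qed
  qed
  then show ?thesis by (simp add: D_def Ball_def imp_conjL)
qed

section \<open>Homogeneous symbols\<close>

lemma coeff_symbol_top: "coeff (symbol r c \<zeta>) r = c r (\<lambda>_. 0)"
proof -
  have "coeff (symbol r c \<zeta>) r = (\<Sum>(k, \<alpha>)\<in>multi_indices r.
      if k = r then c k \<alpha> * (\<Prod>i\<in>UNIV. (\<zeta> $ i) ^ \<alpha> i) else 0)"
    unfolding symbol_def coeff_sum by (intro sum.cong) auto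
  also have "\<dots> = (\<Sum>(k, \<alpha>)\<in>{(r, \<lambda>_. 0)}.
      if k = r then c k \<alpha> * (\<Prod>i\<in>UNIV. (\<zeta> $ i) ^ \<alpha> i) else 0)"
    by (intro sum.mono_neutral_right finite_multi_indices)
      (auto simp: multi_indices_def fun_eq_iff split: if_splits)
  finally show ?thesis by simp
qed

lemma degree_symbol_le: "degree (symbol r c \<zeta>) \<le> r"
  unfolding symbol_def
proof (intro degree_sum_le finite_multi_indices)
  fix x :: "nat \<times> ('a \<Rightarrow> nat)" assume "x \<in> multi_indices r"
  then show "degree (case x of (k, \<alpha>) \<Rightarrow> monom (c k \<alpha> * (\<Prod>i\<in>UNIV. (\<zeta> $ i) ^ \<alpha> i)) k) \<le> r"
    by (auto simp: multi_indices_def intro: order_trans[OF degree_monom_le])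
qed

lemma degree_symbol:
  assumes "c r (\<lambda>_. 0) \<noteq> 0"
  shows "degree (symbol r c \<zeta>) = r" "lead_coeff (symbol r c \<zeta>) = c r (\<lambda>_. 0)"
  using assms degree_symbol_le[of r c \<zeta>] le_degree[of "symbol r c \<zeta>" r] by (auto simp: coeff_symbol_top)

lemma poly_symbol_scale:
  "poly (symbol r c (s *s \<zeta>)) (s * z) = s ^ r * poly (symbol r c \<zeta>) z"
  unfolding poly_symbol sum_distrib_left
proof (intro sum.cong refl, clarify)
  fix k and \<alpha> :: "'a \<Rightarrow> nat" assume "(k, \<alpha>) \<in> multi_indices r"
  then have r: "r = k + (\<Sum>i\<in>UNIV. \<alpha> i)" by (simp add: multi_indices_def)
  show "c k \<alpha> * (s * z) ^ k * (\<Prod>i\<in>UNIV. ((s *s \<zeta>) $ i) ^ \<alpha> i) =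
      s ^ r * (c k \<alpha> * z ^ k * (\<Prod>i\<in>UNIV. (\<zeta> $ i) ^ \<alpha> i))"
    by (simp add: r power_add power_sum power_mult_distrib prod.distrib)
qed

text \<open>
  The substitution \<open>w = s z\<close> turns the sum of symbols of different orders into a perturbation problem
  with small parameter \<open>1 / s\<close>; it will be used with \<open>s = i |\<xi>|\<close>.
\<close>
lemma homogeneous_factorization:
  assumes m: "m \<ge> 2" and J: "card J = m" and s: "s \<noteq> 0"
    and eq: "symbol m c \<zeta> + smult (1 / s) (symbol (m - 1) c' \<zeta>) + smult ((1 / s)\<^sup>2) (symbol (m - 2) c'' \<zeta>) =
      (\<Prod>j\<in>J. [:- \<mu> j, 1:])"
  shows "symbol m c (s *s \<zeta>) + symbol (m - 1) c' (s *s \<zeta>) + symbol (m - 2) c'' (s *s \<zeta>) =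
      (\<Prod>j\<in>J. [:- (s * \<mu> j), 1:])"
proof (rule poly_ext)
  fix w
  define z where "z = w / s"
  have w: "w = s * z" using s by (simp add: z_def)
  have pow: "s ^ m = s * s ^ (m - 1)" "s ^ m = s\<^sup>2 * s ^ (m - 2)"
  proof -
    obtain n where "m = n + 2" using m by (metis add.commute le_Suc_ex)
    then show "s ^ m = s * s ^ (m - 1)" "s ^ m = s\<^sup>2 * s ^ (m - 2)"
      by (simp_all add: power2_eq_square)
  qed
  have "poly (symbol m c (s *s \<zeta>) + symbol (m - 1) c' (s *s \<zeta>) + symbol (m - 2) c'' (s *s \<zeta>)) w =
      s ^ m * poly (symbol m c \<zeta>) z + s ^ (m - 1) * poly (symbol (m - 1) c' \<zeta>) z
      + s ^ (m - 2) * poly (symbol (m - 2) c'' \<zeta>) z"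
    by (simp add: w poly_symbol_scale)
  also have "\<dots> = s ^ m * poly (symbol m c \<zeta> + smult (1 / s) (symbol (m - 1) c' \<zeta>)
      + smult ((1 / s)\<^sup>2) (symbol (m - 2) c'' \<zeta>)) z"
  proof -
    have "s ^ (m - 1) = s ^ m * (1 / s)" "s ^ (m - 2) = s ^ m * (1 / s)\<^sup>2"
      using s by (simp add: pow(1), simp add: pow(2) power_divide)
    then show ?thesis by (simp add: algebra_simps)
  qed
  also have "\<dots> = (\<Prod>j\<in>J. s * (z - \<mu> j))"
    unfolding eq by (simp add: poly_prod prod.distrib J)
  also have "\<dots> = poly (\<Prod>j\<in>J. [:- (s * \<mu> j), 1:]) w"
    by (simp add: poly_prod w algebra_simps)
  finally show "poly (symbol m c (s *s \<zeta>) + symbol (m - 1) c' (s *s \<zeta>) + symbol (m - 2) c'' (s *s \<zeta>)) w =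
      poly (\<Prod>j\<in>J. [:- (s * \<mu> j), 1:]) w" .
qed

section \<open>Asymptotics of the characteristic roots\<close>

theorem lemma5p2:
  fixes m :: nat
    and c\<^sub>m c\<^sub>m\<^sub>1 c\<^sub>m\<^sub>2 :: "nat \<Rightarrow> ('n::finite \<Rightarrow> nat) \<Rightarrow> complex"
    and P\<^sub>m P\<^sub>m\<^sub>1 P\<^sub>m\<^sub>2 Q\<^sub>2 :: "complex ^ 'n \<Rightarrow> complex poly"
    and a b :: "real ^ 'n \<Rightarrow> nat \<Rightarrow> real"
  assumes m: "m \<ge> 3"
    and P\<^sub>m: "P\<^sub>m = symbol m c\<^sub>m"
    and P\<^sub>m\<^sub>1: "P\<^sub>m\<^sub>1 = symbol (m - 1) c\<^sub>m\<^sub>1"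
    and P\<^sub>m\<^sub>2: "P\<^sub>m\<^sub>2 = symbol (m - 2) c\<^sub>m\<^sub>2"
    and Q\<^sub>2: "Q\<^sub>2 = (\<lambda>\<zeta>. P\<^sub>m \<zeta> + P\<^sub>m\<^sub>1 \<zeta> + P\<^sub>m\<^sub>2 \<zeta>)"
    and lead_m: "c\<^sub>m m (\<lambda>_. 0) = 1"
    and lead_m1: "c\<^sub>m\<^sub>1 (m - 1) (\<lambda>_. 0) \<in> \<real>" "Re (c\<^sub>m\<^sub>1 (m - 1) (\<lambda>_. 0)) > 0"
    and lead_m2: "c\<^sub>m\<^sub>2 (m - 2) (\<lambda>_. 0) \<in> \<real>" "Re (c\<^sub>m\<^sub>2 (m - 2) (\<lambda>_. 0)) > 0"
    and hyp_m: "hyperbolic m c\<^sub>m"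
    and hyp_m1: "strictly_hyperbolic (m - 1) c\<^sub>m\<^sub>1"
    and hyp_m2: "hyperbolic (m - 2) c\<^sub>m\<^sub>2"
    and interlace_m2_m1: "\<And>\<xi>'. \<xi>' \<in> sphere 0 1 \<Longrightarrow> interlace (P\<^sub>m\<^sub>2 (cvec \<xi>')) (P\<^sub>m\<^sub>1 (cvec \<xi>'))"
    and interlace_m1_m: "\<And>\<xi>'. \<xi>' \<in> sphere 0 1 \<Longrightarrow> interlace (P\<^sub>m\<^sub>1 (cvec \<xi>')) (P\<^sub>m (cvec \<xi>'))"
    and no_common_root:
      "\<not> (\<exists>(x::real) \<xi>'. \<xi>' \<in> sphere 0 1 \<and> poly (P\<^sub>m\<^sub>2 (cvec \<xi>')) (of_real x) = 0 \<and>
            poly (P\<^sub>m\<^sub>1 (cvec \<xi>')) (of_real x) = 0 \<and> poly (P\<^sub>m (cvec \<xi>')) (of_real x) = 0)"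
    and a: "\<And>\<xi>' j. a \<xi>' j = nth_root (P\<^sub>m (cvec \<xi>')) j"
    and b: "\<And>\<xi>' j. b \<xi>' j = nth_root (P\<^sub>m\<^sub>1 (cvec \<xi>')) j"
  shows "\<exists>lam :: nat \<Rightarrow> real ^ 'n \<Rightarrow> complex.
    (\<forall>\<xi>. proots (Q\<^sub>2 (\<i> *s cvec \<xi>)) = image_mset (\<lambda>j. lam j \<xi>) (mset_set {1..m})) \<and>
    (\<forall>\<xi>'\<in>sphere 0 1.
      (let p\<^sub>m = P\<^sub>m (cvec \<xi>'); p\<^sub>m\<^sub>1 = P\<^sub>m\<^sub>1 (cvec \<xi>'); p\<^sub>m\<^sub>2 = P\<^sub>m\<^sub>2 (cvec \<xi>');
           A = (\<lambda>j. complex_of_real (a \<xi>' j))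
       in
        (\<forall>j\<in>{1..m}.
          poly p\<^sub>m\<^sub>1 (A j) \<noteq> 0 \<and> poly (check1 p\<^sub>m j) (A j) \<noteq> 0 \<longrightarrow>
          (\<lambda>\<rho>::real. lam j (\<rho> *\<^sub>R \<xi>') -
             (\<i> * of_real \<rho> * A j - poly p\<^sub>m\<^sub>1 (A j) / poly (check1 p\<^sub>m j) (A j)))
            \<in> o[at_top](\<lambda>_. 1)) \<and>
        (\<forall>j\<in>{1..m}.
          poly p\<^sub>m\<^sub>1 (A j) = 0 \<and> poly (check1 p\<^sub>m j) (A j) \<noteq> 0 \<longrightarrow>
          (\<lambda>\<rho>::real. lam j (\<rho> *\<^sub>R \<xi>') -
             (\<i> * of_real \<rho> * A j
              + \<i> * (1 / of_real \<rho>) * (poly p\<^sub>m\<^sub>2 (A j) / poly (check1 p\<^sub>m j) (A j))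
              - (1 / of_real \<rho> ^ 2) *
                (poly p\<^sub>m\<^sub>2 (A j) * poly (tilde p\<^sub>m\<^sub>1 p\<^sub>m j) (A j) / (poly (check1 p\<^sub>m j) (A j)) ^ 2)))
            \<in> o[at_top](\<lambda>\<rho>. 1 / of_real \<rho> ^ 2)) \<and>
        (\<forall>j\<in>{1..m - 1}.
          a \<xi>' j = b \<xi>' j \<and> b \<xi>' j = a \<xi>' (j + 1) \<longrightarrow>
          (\<exists>\<kappa>\<^sub>1 \<kappa>\<^sub>2.
            proots [:poly p\<^sub>m\<^sub>2 (A j), poly (check1 p\<^sub>m\<^sub>1 j) (A j), poly (check2 p\<^sub>m j) (A j):] = {#\<kappa>\<^sub>1, \<kappa>\<^sub>2#} \<and>
            (\<lambda>\<rho>::real. lam j (\<rho> *\<^sub>R \<xi>') - (\<i> * of_real \<rho> * A j + \<kappa>\<^sub>1)) \<in> o[at_top](\<lambda>_. 1) \<and>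
            (\<lambda>\<rho>::real. lam (j + 1) (\<rho> *\<^sub>R \<xi>') - (\<i> * of_real \<rho> * A j + \<kappa>\<^sub>2)) \<in> o[at_top](\<lambda>_. 1)))))"
proof -
  have deg_m: "degree (P\<^sub>m \<zeta>) = m" "lead_coeff (P\<^sub>m \<zeta>) = 1" for \<zeta>
    using degree_symbol[of c\<^sub>m m \<zeta>] lead_m unfolding P\<^sub>m by simp_all
  have deg_m1: "degree (P\<^sub>m\<^sub>1 \<zeta>) = m - 1" for \<zeta>
    using degree_symbol[of c\<^sub>m\<^sub>1 "m - 1" \<zeta>] lead_m1 unfolding P\<^sub>m\<^sub>1 by force
  have deg_m2: "degree (P\<^sub>m\<^sub>2 \<zeta>) < m" for \<zeta>
    using degree_symbol_le[of "m - 2" c\<^sub>m\<^sub>2 \<zeta>] m unfolding P\<^sub>m\<^sub>2 by simp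
  have degQ: "degree (Q\<^sub>2 \<zeta>) = m" for \<zeta>
  proof -
    have "degree (P\<^sub>m\<^sub>1 \<zeta> + P\<^sub>m\<^sub>2 \<zeta>) < degree (P\<^sub>m \<zeta>)"
      using deg_m1[of \<zeta>] deg_m2[of \<zeta>] m by (intro degree_add_less) (auto simp: deg_m)
    from degree_add_eq_left[OF this] show ?thesis
      by (simp add: Q\<^sub>2 deg_m add.assoc)
  qed

  define \<epsilon> where "\<epsilon> = (\<lambda>\<rho>::real. 1 / (\<i> * complex_of_real \<rho>))"
  have \<epsilon>_0: "(\<epsilon> \<longlongrightarrow> 0) at_top"
    unfolding tendsto_norm_zero_iff[of \<epsilon>, symmetric]
    using tendsto_inverse_0_at_top[OF filterlim_ident]
    by (rule Lim_transform_eventually)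
      (use eventually_gt_at_top[of 0] in \<open>eventually_elim, simp add: \<epsilon>_def norm_divide norm_mult inverse_eq_divide\<close>)
  have \<epsilon>_nz: "\<forall>\<^sub>F \<rho> in at_top. \<epsilon> \<rho> \<noteq> 0"
    using eventually_gt_at_top[of 0] by eventually_elim (simp add: \<epsilon>_def)

  let ?p = "\<lambda>\<eta>. P\<^sub>m (cvec \<eta>)" and ?q = "\<lambda>\<eta>. P\<^sub>m\<^sub>1 (cvec \<eta>)" and ?r = "\<lambda>\<eta>. P\<^sub>m\<^sub>2 (cvec \<eta>)"
  let ?A = "\<lambda>\<eta> j. complex_of_real (nth_root (?p \<eta>) j)"
  have "\<forall>\<eta>\<in>sphere 0 1. \<exists>\<mu>.
    (\<forall>t. ?p \<eta> + smult (\<epsilon> t) (?q \<eta>) + smult ((\<epsilon> t)\<^sup>2) (?r \<eta>) = (\<Prod>j\<in>{1..m}. [:- \<mu> j t, 1:])) \<and>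
    (\<forall>j\<in>{1..m}. (\<mu> j \<longlongrightarrow> ?A \<eta> j) at_top) \<and>
    (\<forall>j\<in>{1..m-1}. nth_root (?p \<eta>) j = nth_root (?p \<eta>) (Suc j) \<longrightarrow>
      (\<exists>\<kappa> \<kappa>'. proots [:poly (?r \<eta>) (?A \<eta> j), poly (check1 (?q \<eta>) j) (?A \<eta> j),
          poly (check2 (?p \<eta>) j) (?A \<eta> j):] = {#\<kappa>, \<kappa>'#} \<and>
        ((\<lambda>t. (\<mu> j t - ?A \<eta> j) / \<epsilon> t) \<longlongrightarrow> \<kappa>) at_top \<and>
        ((\<lambda>t. (\<mu> (Suc j) t - ?A \<eta> j) / \<epsilon> t) \<longlongrightarrow> \<kappa>') at_top))"
    (is "\<forall>\<eta>\<in>_. \<exists>\<mu>. ?labelling \<eta> \<mu>")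
  proof
    fix \<eta> :: "real ^ 'n" assume \<eta>: "\<eta> \<in> sphere 0 1"
    have "distinct (ordered_roots (?q \<eta>))"
      using hyp_m1 \<eta> by (simp add: strictly_hyperbolic_def P\<^sub>m\<^sub>1)
    from interlacing_perturbation_labelling[OF interlace_m1_m[OF \<eta>] this deg_m(2) _ \<epsilon>_0 \<epsilon>_nz, of "?r \<eta>"]
    show "\<exists>\<mu>. ?labelling \<eta> \<mu>" by (simp only: deg_m deg_m1 deg_m2)
  qed
  from bchoice[OF this] obtain \<mu> where labelling: "\<forall>\<eta>\<in>sphere 0 1. ?labelling \<eta> (\<mu> \<eta>)"
    by (elim exE)
  have factors: "?p \<eta> + smult (\<epsilon> t) (?q \<eta>) + smult ((\<epsilon> t)\<^sup>2) (?r \<eta>) = (\<Prod>j\<in>{1..m}. [:- \<mu> \<eta> j t, 1:])"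
    if "\<eta> \<in> sphere 0 1" for \<eta> t
    using labelling that by blast
  have \<mu>: "(\<mu> \<eta> j \<longlongrightarrow> ?A \<eta> j) at_top" if "\<eta> \<in> sphere 0 1" "j \<in> {1..m}" for \<eta> j
    using labelling that by blast
  have double: "\<exists>\<kappa> \<kappa>'. proots [:poly (?r \<eta>) (?A \<eta> j), poly (check1 (?q \<eta>) j) (?A \<eta> j),
          poly (check2 (?p \<eta>) j) (?A \<eta> j):] = {#\<kappa>, \<kappa>'#} \<and>
        ((\<lambda>t. (\<mu> \<eta> j t - ?A \<eta> j) / \<epsilon> t) \<longlongrightarrow> \<kappa>) at_top \<and>
        ((\<lambda>t. (\<mu> \<eta> (Suc j) t - ?A \<eta> j) / \<epsilon> t) \<longlongrightarrow> \<kappa>') at_top"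
    if "\<eta> \<in> sphere 0 1" "j \<in> {1..m-1}" "nth_root (?p \<eta>) j = nth_root (?p \<eta>) (Suc j)" for \<eta> j
    using labelling that by blast

  obtain lam\<^sub>0 where lam\<^sub>0: "proots (Q\<^sub>2 (\<i> *s cvec 0)) = image_mset lam\<^sub>0 (mset_set {1..m})"
    using mset_indexed_by[of "{1..m}" "proots (Q\<^sub>2 (\<i> *s cvec 0))"] by (auto simp: size_proots_complex degQ)
  \<comment> \<open>the labels are chosen on each ray separately; the origin lies on no ray and gets any labelling\<close>
  define lam where "lam = (\<lambda>j \<xi>. if \<xi> = 0 then lam\<^sub>0 j
    else \<i> * of_real (norm \<xi>) * \<mu> (\<xi> /\<^sub>R norm \<xi>) j (norm \<xi>))"
  have lam_ray: "lam j (\<rho> *\<^sub>R \<eta>) = \<i> * of_real \<rho> * \<mu> \<eta> j \<rho>" if "\<eta> \<in> sphere 0 1" "\<rho> > 0" for j \<rho> \<eta>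
  proof -
    have "\<eta> \<noteq> 0" "norm (\<rho> *\<^sub>R \<eta>) = \<rho>" using that by auto
    then show ?thesis using that by (simp add: lam_def)
  qed

  have all_roots: "proots (Q\<^sub>2 (\<i> *s cvec \<xi>)) = image_mset (\<lambda>j. lam j \<xi>) (mset_set {1..m})" for \<xi>
  proof (cases "\<xi> = 0")
    case True
    then show ?thesis using lam\<^sub>0 by (simp add: lam_def)
  next
    case False
    define \<eta> \<rho> where "\<eta> = \<xi> /\<^sub>R norm \<xi>" and "\<rho> = norm \<xi>"
    have \<eta>: "\<eta> \<in> sphere 0 1" and \<rho>: "\<rho> > 0" and \<xi>: "\<xi> = \<rho> *\<^sub>R \<eta>"
      using False by (simp_all add: \<eta>_def \<rho>_def)
    have arg: "\<i> *s cvec \<xi> = (\<i> * of_real \<rho>) *s cvec \<eta>"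
      by (simp add: \<xi> cvec_def vec_eq_iff)
    have "Q\<^sub>2 (\<i> *s cvec \<xi>) = (\<Prod>j\<in>{1..m}. [:- (\<i> * of_real \<rho> * \<mu> \<eta> j \<rho>), 1:])"
      unfolding Q\<^sub>2 P\<^sub>m P\<^sub>m\<^sub>1 P\<^sub>m\<^sub>2 arg
    proof (rule homogeneous_factorization)
      show "symbol m c\<^sub>m (cvec \<eta>) + smult (1 / (\<i> * of_real \<rho>)) (symbol (m - 1) c\<^sub>m\<^sub>1 (cvec \<eta>)) +
          smult ((1 / (\<i> * of_real \<rho>))\<^sup>2) (symbol (m - 2) c\<^sub>m\<^sub>2 (cvec \<eta>)) = (\<Prod>j\<in>{1..m}. [:- \<mu> \<eta> j \<rho>, 1:])"
        using factors[OF \<eta>, of \<rho>] unfolding \<epsilon>_def P\<^sub>m P\<^sub>m\<^sub>1 P\<^sub>m\<^sub>2 .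
    qed (use m \<rho> in auto)
    then show ?thesis
      by (simp add: proots_prod_linear \<xi> lam_ray[OF \<eta> \<rho>])
  qed

  \<comment> \<open>multiplication by \<open>i \<rho> = 1 / \<epsilon>\<close> turns a first-order expansion in \<open>\<epsilon>\<close> into one up to \<open>o(1)\<close>\<close>
  have zeroth_order:
    "(\<lambda>\<rho>::real. lam j (\<rho> *\<^sub>R \<eta>) -
       (\<i> * of_real \<rho> * ?A \<eta> j' + k)) \<in> o[at_top](\<lambda>_. 1)"
    if "\<eta> \<in> sphere 0 1" and lim: "((\<lambda>t. (\<mu> \<eta> j t - ?A \<eta> j') / \<epsilon> t) \<longlongrightarrow> k) at_top" for \<eta> j j' k
  proof (rule smalloI_tendsto)
    have "((\<lambda>t. (\<mu> \<eta> j t - ?A \<eta> j') / \<epsilon> t - k) \<longlongrightarrow> 0) at_top"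
      using tendsto_diff[OF lim tendsto_const, of k] by simp
    then show "((\<lambda>\<rho>. (lam j (\<rho> *\<^sub>R \<eta>) - (\<i> * of_real \<rho> * ?A \<eta> j' + k)) / 1) \<longlongrightarrow> 0) at_top"
      by (rule Lim_transform_eventually)
        (use eventually_gt_at_top[of 0] in \<open>eventually_elim,
          simp add: \<epsilon>_def lam_ray[OF that(1)] algebra_simps\<close>)
  qed simp

  have root: "poly (?p \<eta> + smult (\<epsilon> t) (?q \<eta>) + smult ((\<epsilon> t)\<^sup>2) (?r \<eta>)) (\<mu> \<eta> j t) = 0"
    if "\<eta> \<in> sphere 0 1" "j \<in> {1..m}" for \<eta> j t
    unfolding factors[OF that(1)] poly_prod using that(2) by (intro prod_zero) auto
  have p_split: "?p \<eta> = [:- ?A \<eta> j, 1:] * check1 (?p \<eta>) j" if "\<eta> \<in> sphere 0 1" "j \<in> {1..m}" for \<eta> j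
    using check1_factorization(1)[OF interlaceD(3)[OF interlace_m1_m[OF that(1)]], of j] that(2) unfolding deg_m .

  have simple: "(\<lambda>\<rho>::real. lam j (\<rho> *\<^sub>R \<eta>) -
      (\<i> * of_real \<rho> * ?A \<eta> j - poly (?q \<eta>) (?A \<eta> j) / poly (check1 (?p \<eta>) j) (?A \<eta> j)))
      \<in> o[at_top](\<lambda>_. 1)"
    if \<eta>: "\<eta> \<in> sphere 0 1" and j: "j \<in> {1..m}" and nz: "poly (check1 (?p \<eta>) j) (?A \<eta> j) \<noteq> 0" for \<eta> j
    using zeroth_order[OF \<eta> simple_root_first_order[OF p_split[OF \<eta> j] nz \<epsilon>_0 \<epsilon>_nz \<mu>[OF \<eta> j]
        always_eventually[OF allI[OF root[OF \<eta> j]]]]]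
    by simp

  have shared: "(\<lambda>\<rho>::real. lam j (\<rho> *\<^sub>R \<eta>) -
      (\<i> * of_real \<rho> * ?A \<eta> j
       + \<i> * (1 / of_real \<rho>) * (poly (?r \<eta>) (?A \<eta> j) / poly (check1 (?p \<eta>) j) (?A \<eta> j))
       - (1 / of_real \<rho> ^ 2) *
         (poly (?r \<eta>) (?A \<eta> j) * poly (tilde (?q \<eta>) (?p \<eta>) j) (?A \<eta> j) / (poly (check1 (?p \<eta>) j) (?A \<eta> j)) ^ 2)))
      \<in> o[at_top](\<lambda>\<rho>. 1 / of_real \<rho> ^ 2)"
    if \<eta>: "\<eta> \<in> sphere 0 1" and j: "j \<in> {1..m}" and nz: "poly (check1 (?p \<eta>) j) (?A \<eta> j) \<noteq> 0"
      and common: "poly (?q \<eta>) (?A \<eta> j) = 0" for \<eta> j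
  proof -
    have "?q \<eta> \<noteq> 0" using deg_m1[of "cvec \<eta>"] m by auto
    from tilde_factorization[OF interlace_m1_m[OF \<eta>] this _ common nz] j
    have q_split: "?q \<eta> = [:- ?A \<eta> j, 1:] * tilde (?q \<eta>) (?p \<eta>) j" by (simp only: deg_m)
    define u v where "u = poly (?r \<eta>) (?A \<eta> j) / poly (check1 (?p \<eta>) j) (?A \<eta> j)"
      and "v = poly (?r \<eta>) (?A \<eta> j) * poly (tilde (?q \<eta>) (?p \<eta>) j) (?A \<eta> j) / (poly (check1 (?p \<eta>) j) (?A \<eta> j)) ^ 2"
    have lim: "((\<lambda>t. ((\<mu> \<eta> j t - ?A \<eta> j) + (\<epsilon> t)\<^sup>2 * u - (\<epsilon> t) ^ 3 * v) / (\<epsilon> t) ^ 3) \<longlongrightarrow> 0) at_top"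
      unfolding u_def v_def
      by (rule common_simple_root_third_order[OF p_split[OF \<eta> j] q_split nz \<epsilon>_0 \<epsilon>_nz \<mu>[OF \<eta> j]
        always_eventually[OF allI[OF root[OF \<eta> j]]]])
    show ?thesis
      unfolding u_def[symmetric] v_def[symmetric]
    proof (rule smalloI_tendsto)
      \<comment> \<open>\<open>(1 / \<epsilon>) \<rho>\<^sup>2 = - 1 / \<epsilon>\<^sup>3\<close> because \<open>\<epsilon>\<^sup>2 = - 1 / \<rho>\<^sup>2\<close>\<close>
      have "((\<lambda>t. - (((\<mu> \<eta> j t - ?A \<eta> j) + (\<epsilon> t)\<^sup>2 * u - (\<epsilon> t) ^ 3 * v) / (\<epsilon> t) ^ 3)) \<longlongrightarrow> 0) at_top"
        using tendsto_minus[OF lim] by simp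
      then show "((\<lambda>\<rho>. (lam j (\<rho> *\<^sub>R \<eta>) - (\<i> * of_real \<rho> * ?A \<eta> j + \<i> * (1 / of_real \<rho>) * u
          - (1 / of_real \<rho> ^ 2) * v)) / (1 / of_real \<rho> ^ 2)) \<longlongrightarrow> 0) at_top"
        by (rule Lim_transform_eventually)
          (use eventually_gt_at_top[of 0] in \<open>eventually_elim,
            simp add: \<epsilon>_def lam_ray[OF \<eta>] field_simps power2_eq_square power3_eq_cube\<close>)
      show "\<forall>\<^sub>F \<rho>::real in at_top. 1 / complex_of_real \<rho> ^ 2 \<noteq> 0"
        using eventually_gt_at_top[of 0] by eventually_elim simp
    qed
  qed

  have double_asymptotics: "\<exists>\<kappa>\<^sub>1 \<kappa>\<^sub>2.
      proots [:poly (?r \<eta>) (?A \<eta> j), poly (check1 (?q \<eta>) j) (?A \<eta> j), poly (check2 (?p \<eta>) j) (?A \<eta> j):]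
        = {#\<kappa>\<^sub>1, \<kappa>\<^sub>2#} \<and>
      (\<lambda>\<rho>::real. lam j (\<rho> *\<^sub>R \<eta>) - (\<i> * of_real \<rho> * ?A \<eta> j + \<kappa>\<^sub>1)) \<in> o[at_top](\<lambda>_. 1) \<and>
      (\<lambda>\<rho>::real. lam (j + 1) (\<rho> *\<^sub>R \<eta>) - (\<i> * of_real \<rho> * ?A \<eta> j + \<kappa>\<^sub>2)) \<in> o[at_top](\<lambda>_. 1)"
    if \<eta>: "\<eta> \<in> sphere 0 1" and j: "j \<in> {1..m-1}" and eq: "nth_root (?p \<eta>) j = nth_root (?p \<eta>) (j + 1)" for \<eta> j
    using double[OF \<eta> j eq[unfolded Suc_eq_plus1[symmetric]]] zeroth_order[OF \<eta>]
    unfolding Suc_eq_plus1 by blast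

  show ?thesis
    unfolding Let_def a b
  proof (intro exI[of _ lam] conjI allI ballI impI, goal_cases)
    case (1 \<xi>)
    show ?case by (rule all_roots)
  next
    case (2 \<eta> j)
    then show ?case using simple by blast
  next
    case (3 \<eta> j)
    then show ?case using shared by blast
  next
    case (4 \<eta> j)
    then have "nth_root (?p \<eta>) j = nth_root (?p \<eta>) (j + 1)" by (elim conjE) (rule trans)
    with 4(1,2) show ?case by (rule double_asymptotics)
  qed
qed

end
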